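(* Let $P,Q,N$ be as in the context and let $g$ be a nontrivial entire solution of $g''-\frac{P'}{P}g'+\frac QPg=0$. Let $\{t_n\}$ be a Stokes sequence of $g$, i.e. the sequence of zeros of $g$ lying in one sector $G_k(r,\delta)$ (as in the context) for which $\lambda_k^+\lambda_k^-\ne0$, and put $$c_n=\frac{P(t_n)}{g'(t_n)^2}.$$ Then, for every $\alpha\in\mathbb R$, $$\frac{|c_n|}{|t_n|^{1+\alpha}}\asymp n^{-1-\frac{2\alpha}{N+2}},\qquad n\to\infty .$$ Consequently, $$\sum_{n=1}^{\infty}\frac{|c_n|}{|t_n|^{1+\alpha}}<\infty\iff\alpha>0 .$$ The same equivalence holds for the union of all Stokes sequences of $g$.
   Context: Setting. $P(z)=z^p+az^{p-1}+O(z^{p-2})$ and $Q(z)=bz^q+cz^{q-1}+O(z^{q-2})$ are polynomials, $b\ne0$, $q\ge p\ge0$, $N=q-p$, and $Q/P$ equals a polynomial of degree $N$ plus a sum $\sum_j D_j/(z-p_j)$ over the zeros $p_j$ of $P$ (at most simple poles). Put $d=\frac{ab-c}{bN}$ if $N\ge1$, $d=0$ if $N=0$, $\theta_k=\frac{2\pi k-\arg b}{N+2}$ ($k\in\mathbb Z$, taken modulo $N+2$), and $$G_k(r,\delta)=\{z:|z-d|>r,\ \arg(z-d)\in(\theta_{k-1}+\delta,\theta_{k+1}-\delta)\},\quad k=0,\dots,N+1 .$$ For each $k$, with suitable large $r$ and small $\delta>0$, the equation has in $G_k(r,\delta)$ a fundamental pair of solutions $g_k^\pm$ with $g_k^\pm(z)=(z-d)^{\frac{3p-q}{4}}\exp\bigl(\frac{\pm2i\sqrt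 b}{N+2}(z-d)^{\frac{N+2}2}(1+o(1))\bigr)(1+O((z-d)^{-1}))$ as $z\to\infty$, and $\lambda_k^\pm$ are the constants with $g=\lambda_k^+g_k^++\lambda_k^-g_k^-$ there. The condition $\lambda_k^+\lambda_k^-\neq0$ is equivalent to $g$ having infinitely many zeros in $G_k(r,\delta)$. Zeros are enumerated in order of nondecreasing modulus (terms with $t_n=0$, if any, are omitted). $x_n\asymp y_n$ means $x_n/y_n$ is bounded above and below by positive constants for large $n$. *)

theory Defs
  imports "HOL-Complex_Analysis.Complex_Analysis" "HOL-Library.Landau_Symbols"
    "HOL-Computational_Algebra.Polynomial"
begin

definition ode_setting :: "complex poly \<Rightarrow> complex poly \<Rightarrow> bool" where
  "ode_setting P Q \<longleftrightarrow> lead_coeff P = 1 \<and> Q \<noteq> 0 \<and> degree P \<le> degree Q \<and>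
     (\<exists>R D. degree R = degree Q - degree P \<and>
       (\<forall>z. poly P z \<noteq> 0 \<longrightarrow>
          poly Q z / poly P z = poly R z + (\<Sum>w | poly P w = 0. D w / (z - w))))"

definition gap :: "complex poly \<Rightarrow> complex poly \<Rightarrow> nat" where
  "gap P Q = degree Q - degree P"

(* coeff p (degree p - 1) is only the subleading coefficient if degree p > 0;
   for constants the term of degree -1 is absent. *)
definition subleading_coeff :: "complex poly \<Rightarrow> complex" where
  "subleading_coeff p = (if degree p = 0 then 0 else coeff p (degree p - 1))"

definition centre :: "complex poly \<Rightarrow> complex poly \<Rightarrow> complex" where
  "centre P Q =
     (if gap P Q = 0 then 0
      else (subleading_coeff P * lead_coeff Q - subleading_coeff Q)
             / (lead_coeff Q * of_nat (gap P Q)))"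

definition theta :: "complex poly \<Rightarrow> complex poly \<Rightarrow> int \<Rightarrow> real" where
  "theta P Q k = (2 * pi * of_int k - Arg (lead_coeff Q)) / (real (gap P Q) + 2)"

definition sector :: "complex poly \<Rightarrow> complex poly \<Rightarrow> int \<Rightarrow> real \<Rightarrow> real \<Rightarrow> complex set" where
  "sector P Q k r \<delta> =
     {z. cmod (z - centre P Q) > r \<and>
         (\<exists>\<phi>. theta P Q (k - 1) + \<delta> < \<phi> \<and> \<phi> < theta P Q (k + 1) - \<delta> \<and>
              z - centre P Q = of_real (cmod (z - centre P Q)) * cis \<phi>)}"

(* "Large r and small delta": the sector contains its central ray and no singular point of
   the equation. *)
definition suitable :: "complex poly \<Rightarrow> complex poly \<Rightarrow> int \<Rightarrow> real \<Rightarrow> real \<Rightarrow> bool" where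
  "suitable P Q k r \<delta> \<longleftrightarrow> 0 < r \<and> 0 < \<delta> \<and> \<delta> < 2 * pi / (real (gap P Q) + 2) \<and>
     (\<forall>z\<in>sector P Q k r \<delta>. poly P z \<noteq> 0)"

definition solves_ode_on ::
  "complex poly \<Rightarrow> complex poly \<Rightarrow> complex set \<Rightarrow> (complex \<Rightarrow> complex) \<Rightarrow> bool" where
  "solves_ode_on P Q S f \<longleftrightarrow> f holomorphic_on S \<and>
     (\<forall>z\<in>S. poly P z \<noteq> 0 \<longrightarrow>
        deriv (deriv f) z - poly (pderiv P) z / poly P z * deriv f z
          + poly Q z / poly P z * f z = 0)"

(* The branch of (z - d)^s on the k-th sector given by the argument of z - d that lies in
   (theta (k-1), theta (k+1)); it differs from theta k by less than pi, so that the principal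
   logarithm of the rotated argument may be used. *)
definition sector_pow ::
  "complex poly \<Rightarrow> complex poly \<Rightarrow> int \<Rightarrow> complex \<Rightarrow> complex \<Rightarrow> complex" where
  "sector_pow P Q k z s =
     exp (s * (Ln ((z - centre P Q) * cis (- theta P Q k)) + \<i> * of_real (theta P Q k)))"

(* The parameter \<sigma> is 1 or -1. *)
definition has_asymptotic_form ::
  "complex poly \<Rightarrow> complex poly \<Rightarrow> int \<Rightarrow> real \<Rightarrow> real \<Rightarrow> complex \<Rightarrow> (complex \<Rightarrow> complex) \<Rightarrow> bool" where
  "has_asymptotic_form P Q k r \<delta> \<sigma> f \<longleftrightarrow>
     (let F = inf at_infinity (principal (sector P Q k r \<delta>)) in
      \<exists>\<epsilon> \<eta>. (\<epsilon> \<longlongrightarrow> 0) F \<and> \<eta> \<in> O[F](\<lambda>z. inverse (z - centre P Q)) \<and>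
        (\<forall>\<^sub>F z in F. f z =
           sector_pow P Q k z ((3 * of_nat (degree P) - of_nat (degree Q)) / 4)
           * exp (\<sigma> * (2 * \<i> * csqrt (lead_coeff Q) / (of_nat (gap P Q) + 2))
                  * sector_pow P Q k z ((of_nat (gap P Q) + 2) / 2) * (1 + \<epsilon> z))
           * (1 + \<eta> z)))"

definition asymptotic_pair ::
  "complex poly \<Rightarrow> complex poly \<Rightarrow> int \<Rightarrow> real \<Rightarrow> real
    \<Rightarrow> (complex \<Rightarrow> complex) \<Rightarrow> (complex \<Rightarrow> complex) \<Rightarrow> bool" where
  "asymptotic_pair P Q k r \<delta> gp gm \<longleftrightarrow>
     solves_ode_on P Q (sector P Q k r \<delta>) gp \<and> solves_ode_on P Q (sector P Q k r \<delta>) gm \<and>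
     (\<forall>u v. (\<forall>z\<in>sector P Q k r \<delta>. u * gp z + v * gm z = 0) \<longrightarrow> u = 0 \<and> v = 0) \<and>
     has_asymptotic_form P Q k r \<delta> 1 gp \<and> has_asymptotic_form P Q k r \<delta> (-1) gm"

(* Each member of an asymptotic pair is recessive in one half of the sector, so the pair is
   determined up to nonzero constant factors and the condition lp * lm \<noteq> 0 does not depend
   on its choice. *)
definition stokes_index ::
  "complex poly \<Rightarrow> complex poly \<Rightarrow> (complex \<Rightarrow> complex) \<Rightarrow> int \<Rightarrow> real \<Rightarrow> real \<Rightarrow> bool" where
  "stokes_index P Q g k r \<delta> \<longleftrightarrow> 0 \<le> k \<and> k \<le> int (gap P Q) + 1 \<and>
     (\<exists>gp gm lp lm. asymptotic_pair P Q k r \<delta> gp gm \<and>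
        (\<forall>z\<in>sector P Q k r \<delta>. g z = lp * gp z + lm * gm z) \<and> lp * lm \<noteq> 0)"

(* Away from the zeros of P the zeros of g are simple, so a set of zeros carries no
   multiplicities; a zero at the origin is omitted. *)
definition sector_zeros ::
  "complex poly \<Rightarrow> complex poly \<Rightarrow> (complex \<Rightarrow> complex) \<Rightarrow> int \<Rightarrow> real \<Rightarrow> real \<Rightarrow> complex set" where
  "sector_zeros P Q g k r \<delta> = {z \<in> sector P Q k r \<delta>. g z = 0 \<and> z \<noteq> 0}"

(* Sequences are indexed from 1; the value t 0 is irrelevant. *)
definition stokes_sequence ::
  "complex poly \<Rightarrow> complex poly \<Rightarrow> (complex \<Rightarrow> complex) \<Rightarrow> int \<Rightarrow> real \<Rightarrow> real
    \<Rightarrow> (nat \<Rightarrow> complex) \<Rightarrow> bool" where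
  "stokes_sequence P Q g k r \<delta> t \<longleftrightarrow> stokes_index P Q g k r \<delta> \<and>
     bij_betw t {1..} (sector_zeros P Q g k r \<delta>) \<and> mono_on {1..} (\<lambda>n. cmod (t n))"

definition residue_coeff :: "complex poly \<Rightarrow> (complex \<Rightarrow> complex) \<Rightarrow> complex \<Rightarrow> complex" where
  "residue_coeff P g z = poly P z / (deriv g z)\<^sup>2"

end

(* On a Stokes sector put h = g_+/g_- and x = beta ((z - d) exp(-i theta_k))^((N+2)/2), so that the
   central ray becomes the positive axis. The asymptotic forms only give log |h| = -2 s Im x + o(|x|)
   with s = (-1)^k. But log h - 2 i s x is holomorphic, so its derivative is controlled by its real part
   on discs of radius comparable to |x|; hence |h'/h| is comparable to 1 in a narrower wedge around the
   axis. There log h is close to 2 i s x, so the zeros of g, being a level set of h, are close to an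
   arithmetic progression of step pi in x, and |t_n| is comparable to n^(2/(N+2)).
   By Abel's identity g_+ g_-' - g_+' g_- = C P, and therefore c_n = -1/(lambda_+^2 C (dh/dz)(t_n)),
   which by the bound on h'/h has size |t_n|^(-N/2). *)
theory Submission
  imports Defs
begin

text \<open>The factor 1 + o(1) in the exponents leaves an error o(|x|) in log h that may be
  unbounded, so the zeros cannot be placed within o(1) of given points. What is small is its
  derivative, and smallness below a fixed constant suffices: with log h = 2 i s (x + E x) and E
  Lipschitz with a small constant, x + E x is a perturbation of the identity. It is injective and
  attains every far point of the progression, so far zeros correspond to integers one to one, each
  displaced by at most a fixed fraction of its modulus. Two-sided bounds ask for no more.

  The asymptotics hold on the whole sector, whose image in x is a far part of |Arg x| < pi - delta
  (N+2)/2, but the logarithm is controlled only in a wedge. Far zeros outside it are impossible,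
  because there |Im x| is at least a fixed fraction of |x|, so |h| is exponentially large or small
  and cannot equal |lambda_- / lambda_+|.

  The zeros so obtained are numbered along the progression and not by modulus, and finitely many
  zeros are missed. Counting reconciles the two numberings.\<close>

section \<open>Logarithms with controlled real part on a wedge\<close>

text \<open>Cauchy's inequality needs a bound on a modulus, and here only Re f is bounded. The
  function exp ((f - f x) / (2M)) has modulus at most e < 3 on the disc and derivative f' x / (2M)
  at its centre, whence 6 = 2 * 3.\<close>

lemma deriv_bound_Re:
  fixes f :: "complex \<Rightarrow> complex"
  assumes holf: "f holomorphic_on S" and S: "open S" "cball x \<rho> \<subseteq> S" and "0 < \<rho>" "0 < M"
    and bnd: "\<And>y. y \<in> cball x \<rho> \<Longrightarrow> \<bar>Re (f y)\<bar> \<le> M"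
  shows "cmod (deriv f x) \<le> 6 * M / \<rho>"
proof -
  define F where "F = (\<lambda>y. exp ((f y - f x) / of_real (2 * M)))"
  have x: "x \<in> S"
    using S \<open>0 < \<rho>\<close> by (meson centre_in_cball less_imp_le subsetD)
  have holF: "F holomorphic_on S"
    unfolding F_def using holf \<open>0 < M\<close> by (intro holomorphic_intros) auto
  have "(f has_field_derivative deriv f x) (at x)"
    using holf S(1) x by (rule holomorphic_derivI)
  then have "(F has_field_derivative deriv f x / of_real (2 * M)) (at x)"
    unfolding F_def using \<open>0 < M\<close> by (auto intro!: derivative_eq_intros)
  then have dF: "deriv F x = deriv f x / of_real (2 * M)"
    by (rule DERIV_imp_deriv)
  have "cmod ((deriv ^^ 1) F x) \<le> fact 1 * 3 / \<rho> ^ 1"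
  proof (rule Cauchy_inequality)
    show "F holomorphic_on ball x \<rho>"
      using holF S(2) ball_subset_cball by (meson holomorphic_on_subset)
    show "continuous_on (cball x \<rho>) F"
      using holF S(2) by (meson holomorphic_on_imp_continuous_on continuous_on_subset)
    fix y assume "cmod (x - y) = \<rho>"
    then have "y \<in> cball x \<rho>" by (simp add: dist_norm)
    then have "Re (f y) - Re (f x) \<le> 2 * M"
      using bnd[of y] bnd[of x] \<open>0 < \<rho>\<close> by force
    then have "Re ((f y - f x) / of_real (2 * M)) \<le> 1"
      using \<open>0 < M\<close> by (subst Re_divide_of_real) (simp add: divide_simps)
    then have "cmod (F y) \<le> exp 1"
      unfolding F_def norm_exp_eq_Re by (simp only: exp_le_cancel_iff)
    then show "cmod (F y) \<le> 3"
      using exp_le by linarith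
  qed fact
  then show ?thesis
    using \<open>0 < M\<close> \<open>0 < \<rho>\<close> by (simp add: dF norm_divide divide_simps mult.commute)
qed

text \<open>Cutting off by a vertical line and not by a circle keeps the set convex. Convexity
  yields the holomorphic logarithm, the Lipschitz bound for its error term and the constancy of the
  pulled-back Wronskian quotient.\<close>

definition wedge :: "real \<Rightarrow> real \<Rightarrow> complex set" where
  "wedge c X = {x. X < Re x \<and> \<bar>Im x\<bar> < c * Re x}"

lemma open_wedge: "open (wedge c X)"
  unfolding wedge_def by (intro open_Collect_conj open_Collect_less continuous_intros)

lemma convex_wedge: "convex (wedge c X)"
proof -
  have *: "wedge c X = {x. 1 \<bullet> x > X} \<inter> {x. Complex c 1 \<bullet> x > 0} \<inter> {x. Complex c (-1) \<bullet> x > 0}"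
    unfolding wedge_def by (auto simp: inner_complex_def abs_less_iff)
  show ?thesis
    unfolding * by (intro convex_Int convex_halfspace_gt)
qed

lemma wedge_mono: "c \<le> c' \<Longrightarrow> X' \<le> X \<Longrightarrow> 0 \<le> X \<Longrightarrow> wedge c X \<subseteq> wedge c' X'"
  unfolding wedge_def by (smt (verit) mem_Collect_eq mult_right_mono subsetI)

lemma norm_le_wedge:
  assumes "x \<in> wedge c X" "c \<le> 1" "0 \<le> X"
  shows "cmod x \<le> 2 * Re x"
proof -
  have "c * Re x \<le> 1 * Re x"
    using assms by (intro mult_right_mono) (auto simp: wedge_def)
  then show ?thesis
    using assms cmod_le[of x] unfolding wedge_def by (smt (verit) mem_Collect_eq)
qed

text \<open>The radius is a fixed fraction of Re p, so that a Cauchy estimate divides an error of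
  order |x| by a length of order |x| and leaves a bounded derivative.\<close>

lemma cball_subset_wedge:
  assumes "p \<in> wedge (c/2) (2 * X)" "0 < c" "c \<le> 1" "0 \<le> X"
  shows "cball p (c/4 * Re p) \<subseteq> wedge c X"
proof
  fix y assume "y \<in> cball p (c/4 * Re p)"
  then have n: "cmod (y - p) \<le> c/4 * Re p" by (simp add: dist_norm norm_minus_commute)
  have re: "\<bar>Re y - Re p\<bar> \<le> c/4 * Re p" and im: "\<bar>Im y - Im p\<bar> \<le> c/4 * Re p"
    using n abs_Re_le_cmod[of "y - p"] abs_Im_le_cmod[of "y - p"] by auto
  have p: "2 * X < Re p" "\<bar>Im p\<bar> < c/2 * Re p" using assms by (auto simp: wedge_def)
  have "c * Re p \<le> 1 * Re p"
    using assms p by (intro mult_right_mono) auto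
  then have y: "3/4 * Re p \<le> Re y" using re by linarith
  have "\<bar>Im y\<bar> < c * (3/4 * Re p)" using im p by linarith
  also have "\<dots> \<le> c * Re y" using y assms by (intro mult_left_mono) auto
  finally show "y \<in> wedge c X" using y p assms by (auto simp: wedge_def)
qed

text \<open>The hypothesis bounds the real part of log h - 2 i s x = 2 i s E x. Of the factor c^2 in
  it, one c is lost to the disc radius c/4 * Re x; the other keeps the displacement E small relative
  to the opening of the wedge.\<close>

lemma wedge_log_deriv:
  fixes h :: "complex \<Rightarrow> complex"
  assumes c: "0 < c" "c \<le> 1" and X: "1 \<le> X" and s: "s = 1 \<or> s = (-1 :: real)"
    and holh: "h holomorphic_on wedge c X"
    and nz: "\<And>x. x \<in> wedge c X \<Longrightarrow> h x \<noteq> 0"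
    and bnd: "\<And>x. x \<in> wedge c X \<Longrightarrow> \<bar>ln (cmod (h x)) + 2 * s * Im x\<bar> \<le> c\<^sup>2 / 4000 * cmod x"
  obtains E where "E holomorphic_on wedge c X"
    "\<And>x. x \<in> wedge c X \<Longrightarrow> h x = exp (2 * \<i> * of_real s * (x + E x))"
    "\<And>x. x \<in> wedge (c/2) (2 * X) \<Longrightarrow> cmod (deriv E x) \<le> c / 80"
proof -
  have "contractible (wedge c X)"
    by (rule convex_imp_contractible[OF convex_wedge])
  then obtain L where holL: "L holomorphic_on wedge c X"
    and L: "\<And>x. x \<in> wedge c X \<Longrightarrow> h x = exp (L x)"
    using contractible_imp_holomorphic_log[OF holh _ nz] by metis
  have ss: "of_real s * of_real s = (1::complex)" using s by auto
  define E where "E = (\<lambda>x. L x / (2 * \<i> * of_real s) - x)"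
  have s0: "2 * \<i> * of_real s \<noteq> 0" using s by auto
  have holE: "E holomorphic_on wedge c X"
    unfolding E_def using s0 by (intro holomorphic_intros holL) auto
  define F where "F = (\<lambda>x. 2 * \<i> * of_real s * E x)"
  have holF: "F holomorphic_on wedge c X"
    unfolding F_def by (intro holomorphic_intros holE)
  have LE: "L x = 2 * \<i> * of_real s * (x + E x)" for x
    using s0 unfolding E_def by simp
  have F: "F x = L x - 2 * \<i> * of_real s * x" for x
    unfolding F_def LE by (simp add: algebra_simps)
  have dE: "cmod (deriv E x) \<le> c / 80" if x: "x \<in> wedge (c/2) (2 * X)" for x
  proof -
    have Rex: "2 * X < Re x" using x by (simp add: wedge_def)
    define \<rho> where "\<rho> = c/4 * Re x"
    have sub: "cball x \<rho> \<subseteq> wedge c X"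
      unfolding \<rho>_def using cball_subset_wedge[OF x] c X by simp
    have \<rho>: "0 < \<rho>" using Rex X c by (simp add: \<rho>_def)
    have xS: "x \<in> wedge c X" using sub \<rho> by (meson centre_in_cball less_imp_le subsetD)
    \<comment> \<open>On the disc |y| <= 3 Re x. Dividing 6 * (c^2/4000) * 3 Re x by c/4 * Re x
      gives 72 c/4000, and division by |2 i s| = 2 leaves less than c/80.\<close>
    have "cmod (deriv F x) \<le> 6 * (c\<^sup>2 / 4000 * (3 * Re x)) / \<rho>"
    proof (rule deriv_bound_Re[OF holF open_wedge sub \<rho>])
      show "0 < c\<^sup>2 / 4000 * (3 * Re x)" using c Rex X by simp
      fix y assume y: "y \<in> cball x \<rho>"
      have "Re (F y) = ln (cmod (h y)) + 2 * s * Im y"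
        using L y sub by (auto simp: F norm_exp_eq_Re)
      moreover have "cmod y \<le> 3 * Re x"
      proof -
        have "cmod y \<le> cmod x + \<rho>"
          using y norm_triangle_sub[of y x] by (simp add: dist_norm norm_minus_commute)
        moreover have "cmod x \<le> 2 * Re x" using norm_le_wedge[OF x] c X by auto
        moreover have "\<rho> \<le> Re x" unfolding \<rho>_def
          using c Rex X by (simp add: mult_left_le_one_le)
        ultimately show ?thesis by linarith
      qed
      then have "c\<^sup>2 / 4000 * cmod y \<le> c\<^sup>2 / 4000 * (3 * Re x)"
        by (intro mult_left_mono) auto
      ultimately show "\<bar>Re (F y)\<bar> \<le> c\<^sup>2 / 4000 * (3 * Re x)"
        using bnd[of y] y sub by force
    qed
    also have "\<dots> = 72 * c / 4000"
      using c Rex X by (simp add: \<rho>_def power2_eq_square field_simps)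
    finally have "cmod (deriv F x) \<le> 72 * c / 4000" .
    moreover have "deriv F x = 2 * \<i> * of_real s * deriv E x"
      unfolding F_def using holE xS open_wedge
      by (intro deriv_cmult) (auto simp: holomorphic_on_imp_differentiable_at)
    ultimately have "2 * cmod (deriv E x) \<le> 72 * c / 4000"
      using s by (auto simp: norm_mult)
    then show ?thesis using c by simp
  qed
  show ?thesis
    by (rule that[OF holE _ dE]) (auto simp: L LE)
qed

text \<open>Taking logarithms turns h x = c0 into x + E x = p0 + pi m. Since E is a contraction,
  each m has at most one solution, and Banach's fixed point theorem provides one as soon as m is
  large. Solutions for the other m stay bounded, which is why a bounded exceptional set appears in
  the conclusion.\<close>

lemma wedge_level_set:
  fixes h :: "complex \<Rightarrow> complex"
  assumes c: "0 < c" "c \<le> 1" and X: "1 \<le> X" and s: "s = 1 \<or> s = (-1 :: real)"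
    and c0: "c0 \<noteq> 0"
    and holh: "h holomorphic_on wedge c X"
    and nz: "\<And>x. x \<in> wedge c X \<Longrightarrow> h x \<noteq> 0"
    and bnd: "\<And>x. x \<in> wedge c X \<Longrightarrow> \<bar>ln (cmod (h x)) + 2 * s * Im x\<bar> \<le> c\<^sup>2 / 4000 * cmod x"
  shows "(\<forall>x\<in>wedge (c/2) (2 * X). cmod (h x) \<le> cmod (deriv h x) \<and> cmod (deriv h x) \<le> 3 * cmod (h x)) \<and>
    (\<exists>\<xi> :: nat \<Rightarrow> complex. inj \<xi> \<and> range \<xi> \<subseteq> {x \<in> wedge (c/2) (2 * X). h x = c0} \<and>
       bounded ({x \<in> wedge (c/2) (2 * X). h x = c0} - range \<xi>) \<and>
       (\<exists>a b. 0 < a \<and> 0 < b \<and> (\<forall>m. a * real (Suc m) \<le> cmod (\<xi> m) \<and> cmod (\<xi> m) \<le> b * real (Suc m))))"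
proof -
  obtain E where holE: "E holomorphic_on wedge c X"
    and hE: "\<And>x. x \<in> wedge c X \<Longrightarrow> h x = exp (2 * \<i> * of_real s * (x + E x))"
    and dE: "\<And>x. x \<in> wedge (c/2) (2 * X) \<Longrightarrow> cmod (deriv E x) \<le> c / 80"
    using wedge_log_deriv[OF c X s holh nz bnd] by blast
  define K where "K = wedge (c/2) (2 * X)"
  have Ksub: "K \<subseteq> wedge c X"
    unfolding K_def using c X by (intro wedge_mono) auto
  have derE: "(E has_field_derivative deriv E x) (at x)" if "x \<in> K" for x
    using holE open_wedge that Ksub by (meson holomorphic_derivI subsetD)
  have lip: "cmod (E x - E y) \<le> c / 80 * cmod (x - y)" if "x \<in> K" "y \<in> K" for x y
  proof (rule field_differentiable_bound)
    show "convex K" unfolding K_def by (rule convex_wedge)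
  qed (use derE dE that in \<open>auto simp: K_def intro: has_field_derivative_at_within\<close>)
  \<comment> \<open>Here h'/h = 2 i s (1 + E'), and |E'| <= 1/2 puts its modulus between 1 and
    3.\<close>
  have part1: "cmod (h x) \<le> cmod (deriv h x) \<and> cmod (deriv h x) \<le> 3 * cmod (h x)" if x: "x \<in> K" for x
  proof -
    have xc: "x \<in> wedge c X" using x Ksub by blast
    let ?D = "\<lambda>w. w * (2 * \<i> * of_real s * (1 + deriv E x))"
    have "((\<lambda>x. exp (2 * \<i> * of_real s * (x + E x))) has_field_derivative
        ?D (exp (2 * \<i> * of_real s * (x + E x)))) (at x)"
      by (auto intro!: derivative_eq_intros derE x)
    then have "(h has_field_derivative ?D (exp (2 * \<i> * of_real s * (x + E x)))) (at x)"
      by (rule has_field_derivative_transform_within_open[OF _ open_wedge xc]) (rule hE[symmetric])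
    then have "(h has_field_derivative ?D (h x)) (at x)"
      unfolding hE[OF xc] .
    then have "deriv h x = h x * (2 * \<i> * of_real s * (1 + deriv E x))"
      by (rule DERIV_imp_deriv)
    moreover have "cmod (deriv E x) \<le> 1/2" using dE x c unfolding K_def by force
    then have "1/2 \<le> cmod (1 + deriv E x)" "cmod (1 + deriv E x) \<le> 3/2"
      using norm_triangle_ineq[of 1 "deriv E x"] norm_diff_ineq[of 1 "deriv E x"] by auto
    moreover have "cmod (h x * (2 * \<i> * of_real s * (1 + deriv E x))) = 2 * cmod (1 + deriv E x) * cmod (h x)"
      using s by (auto simp: norm_mult)
    ultimately show ?thesis
      using mult_right_mono[of 1 "2 * cmod (1 + deriv E x)" "cmod (h x)"]
        mult_right_mono[of "2 * cmod (1 + deriv E x)" 3 "cmod (h x)"] by auto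
  qed
  define x0 where "x0 = complex_of_real (2 * X + 1)"
  have x0: "x0 \<in> K" using X c by (auto simp: x0_def K_def wedge_def)
  define C where "C = cmod (E x0) + cmod x0"
  have Ebd: "cmod (E x) \<le> C + c / 80 * cmod x" if "x \<in> K" for x
  proof -
    have "cmod (E x) \<le> cmod (E x0) + c / 80 * cmod (x - x0)"
      using lip[OF that x0] norm_triangle_sub[of "E x" "E x0"] by linarith
    also have "c / 80 * cmod (x - x0) \<le> c / 80 * (cmod x + cmod x0)"
      using c by (intro mult_left_mono norm_triangle_ineq4) auto
    also have "\<dots> \<le> c / 80 * cmod x + cmod x0"
      using c mult_right_mono[of "c/80" 1 "cmod x0"] by (simp add: distrib_left)
    finally show ?thesis unfolding C_def by linarith
  qed
  have C0: "C \<ge> 0" unfolding C_def by simp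
  define p0 where "p0 = Ln c0 / (2 * \<i> * of_real s)"
  have s0: "2 * \<i> * of_real s \<noteq> 0" using s by auto
  have expp0: "exp (2 * \<i> * of_real s * p0) = c0"
    using s0 c0 by (simp add: p0_def)
  \<comment> \<open>The period 2 pi i of exp becomes the step pi after division by 2 i s; for s = -1
    the numbering is merely reversed.\<close>
  have level: "h x = c0 \<longleftrightarrow> (\<exists>m::int. x + E x = p0 + of_real (pi * of_int m))" if "x \<in> K" for x
  proof -
    have "h x = c0 \<longleftrightarrow> exp (2 * \<i> * of_real s * (x + E x)) = exp (2 * \<i> * of_real s * p0)"
      using hE that Ksub expp0 by auto
    also have "\<dots> \<longleftrightarrow> (\<exists>n::int. 2 * \<i> * of_real s * (x + E x) = 2 * \<i> * of_real s * p0 + (of_int (2 * n) * pi) * \<i>)"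
      by (rule exp_eq)
    also have "\<dots> \<longleftrightarrow> (\<exists>n::int. 2 * \<i> * of_real s * (x + E x) = 2 * \<i> * of_real s * (p0 + of_real (pi * (s * of_int n))))"
      using s by (intro ex_cong1) (auto simp: algebra_simps)
    also have "\<dots> \<longleftrightarrow> (\<exists>n::int. x + E x = p0 + of_real (pi * (s * of_int n)))"
      using s0 by (simp only: mult_cancel_left simp_thms)
    also have "\<dots> \<longleftrightarrow> (\<exists>m::int. x + E x = p0 + of_real (pi * of_int m))"
      using s
    proof
      assume "s = -1"
      show ?thesis
      proof
        assume "\<exists>n::int. x + E x = p0 + of_real (pi * (s * of_int n))"
        then obtain n :: int where "x + E x = p0 + of_real (pi * (s * of_int n))" by blast
        then have "x + E x = p0 + of_real (pi * of_int (- n))" using \<open>s = -1\<close> by simp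
        then show "\<exists>m::int. x + E x = p0 + of_real (pi * of_int m)" by blast
      next
        assume "\<exists>n::int. x + E x = p0 + of_real (pi * of_int n)"
        then obtain n :: int where "x + E x = p0 + of_real (pi * of_int n)" by blast
        then have "x + E x = p0 + of_real (pi * (s * of_int (- n)))" using \<open>s = -1\<close> by simp
        then show "\<exists>m::int. x + E x = p0 + of_real (pi * (s * of_int m))" by blast
      qed
    qed auto
    finally show ?thesis .
  qed
  \<comment> \<open>The solution is the fixed point of x |-> p - E x on a disc about p. There |E x|
    <= C + c/80 * 2 Re p, at most (c/8 + c/40) Re p, which is below the radius. The bound on Im p
    keeps the disc in the wedge: c/16 + c/4 < (c/2)(3/4).\<close>
  have ex: "\<exists>x\<in>cball p (c/4 * Re p) \<inter> K. x + E x = p"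
    if p: "\<bar>Im p\<bar> \<le> c/16 * Re p" "8/c * C \<le> Re p" "4 * X \<le> Re p" for p
  proof -
    have Rp: "0 < Re p" using p X by linarith
    have cp: "c * Re p \<le> Re p" using c Rp by simp
    have sub: "cball p (c/4 * Re p) \<subseteq> K"
    proof
      fix y assume "y \<in> cball p (c/4 * Re p)"
      then have n: "cmod (y - p) \<le> c/4 * Re p" by (simp add: dist_norm norm_minus_commute)
      have re: "\<bar>Re y - Re p\<bar> \<le> c/4 * Re p" and im: "\<bar>Im y - Im p\<bar> \<le> c/4 * Re p"
        using n abs_Re_le_cmod[of "y - p"] abs_Im_le_cmod[of "y - p"] by auto
      have y: "3/4 * Re p \<le> Re y" using re cp by linarith
      have "0 < c * Re p" using c Rp by simp
      then have "\<bar>Im y\<bar> < c/2 * (3/4 * Re p)" using im p by linarith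
      also have "\<dots> \<le> c/2 * Re y" using y c by (intro mult_left_mono) auto
      finally show "y \<in> K" using y p X by (auto simp: wedge_def K_def)
    qed
    have "\<exists>!x. x \<in> cball p (c/4 * Re p) \<and> p - E x = x"
    proof (rule Banach_fix[where c = "1/2"])
      show "complete (cball p (c/4 * Re p))" by (intro compact_imp_complete compact_cball)
      show "cball p (c/4 * Re p) \<noteq> {}" using mult_pos_pos[OF c(1) Rp] by simp
      show "(\<lambda>x. p - E x) ` cball p (c/4 * Re p) \<subseteq> cball p (c/4 * Re p)"
      proof safe
        fix x assume x: "x \<in> cball p (c/4 * Re p)"
        then have xK: "x \<in> K" using sub by blast
        have "cmod x \<le> cmod p + c/4 * Re p"
          using x norm_triangle_sub[of x p] by (simp add: dist_norm norm_minus_commute)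
        moreover have "cmod p \<le> Re p + c/16 * Re p"
          using cmod_le[of p] p Rp by linarith
        ultimately have "cmod x \<le> 2 * Re p" using cp Rp by linarith
        then have "c / 80 * cmod x \<le> c / 80 * (2 * Re p)"
          using c by (intro mult_left_mono) auto
        moreover have "C \<le> c / 8 * Re p" using p c by (simp add: field_simps)
        ultimately have "cmod (E x) \<le> c/8 * Re p + c/80 * (2 * Re p)"
          using Ebd[OF xK] by linarith
        also have "\<dots> \<le> c/4 * Re p" using c Rp by simp
        finally show "p - E x \<in> cball p (c/4 * Re p)" by (simp add: dist_norm)
      qed
      fix x y assume xy: "x \<in> cball p (c/4 * Re p)" "y \<in> cball p (c/4 * Re p)"
      have "dist (p - E x) (p - E y) = cmod (E x - E y)"
        by (simp add: dist_norm norm_minus_commute)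
      also have "\<dots> \<le> c/80 * dist x y"
        unfolding dist_norm using xy sub by (intro lip) blast+
      also have "\<dots> \<le> 1/2 * dist x y" using c by (intro mult_right_mono) auto
      finally show "dist (p - E x) (p - E y) \<le> 1/2 * dist x y" .
    qed auto
    then obtain x where "x \<in> cball p (c/4 * Re p)" "p - E x = x" by blast
    then show ?thesis using sub by (metis IntI diff_add_cancel subsetD)
  qed
  \<comment> \<open>The three middle terms are the thresholds of \<open>ex\<close> for points with
    imaginary part Im p0, the last one compensates for Re p0, and the 1 secures Re (p j) >= j +
    1.\<close>
  define M where "M = 1 + 16 / c * \<bar>Im p0\<bar> + 8 / c * C + 4 * X + \<bar>Re p0\<bar>"
  obtain m0 :: nat where m0: "M \<le> real m0" using real_arch_simple by blast
  define p where "p = (\<lambda>j::nat. p0 + of_real (pi * real (m0 + j)))"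
  have Rep: "real (Suc j) + (16 / c * \<bar>Im p0\<bar> + 8 / c * C + 4 * X) \<le> Re (p j)" for j
  proof -
    have "1 * real (m0 + j) \<le> pi * real (m0 + j)"
      using pi_gt3 by (intro mult_right_mono) auto
    then show ?thesis using m0 by (simp add: p_def M_def)
  qed
  have pge: "real (Suc j) \<le> Re (p j)" "8/c * C \<le> Re (p j)" "4 * X \<le> Re (p j)"
    "16 / c * \<bar>Im p0\<bar> \<le> Re (p j)" for j
  proof -
    have "0 \<le> 16 / c * \<bar>Im p0\<bar>" "0 \<le> 8 / c * C" "0 \<le> X" "0 \<le> real (Suc j)"
      using c C0 X by auto
    then show "real (Suc j) \<le> Re (p j)" "8/c * C \<le> Re (p j)" "4 * X \<le> Re (p j)"
      "16 / c * \<bar>Im p0\<bar> \<le> Re (p j)" using Rep[of j] by linarith+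
  qed
  have "\<exists>x\<in>cball (p j) (c/4 * Re (p j)) \<inter> K. x + E x = p j" for j
  proof (rule ex)
    show "\<bar>Im (p j)\<bar> \<le> c/16 * Re (p j)"
      using pge(4)[of j] c by (simp add: p_def field_simps)
  qed (use pge in auto)
  then obtain \<xi> where \<xi>: "\<And>j. \<xi> j \<in> cball (p j) (c/4 * Re (p j)) \<inter> K" "\<And>j. \<xi> j + E (\<xi> j) = p j"
    by metis
  have inj: "inj \<xi>"
  proof (rule injI)
    fix i j assume "\<xi> i = \<xi> j"
    then have "p i = p j" using \<xi>(2) by metis
    then show "i = j" by (simp add: p_def flip: of_real_add)
  qed
  have ran: "range \<xi> \<subseteq> {x \<in> K. h x = c0}"
  proof safe
    fix j show *: "\<xi> j \<in> K" using \<xi>(1) by blast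
    show "h (\<xi> j) = c0"
      unfolding level[OF *] by (intro exI[of _ "int (m0 + j)"]) (simp add: \<xi>(2) p_def)
  qed
  \<comment> \<open>A solution off the list belongs to some m < m0, since for m >= m0 the listed
    solution is the only one. Then Re x is at most A + C + |x|/4, and |x| <= 2 Re x bounds |x|. Very
    negative m need no separate treatment because Re x > 0.\<close>
  have "bounded ({x \<in> K. h x = c0} - range \<xi>)"
  proof (rule boundedI)
    fix x assume x: "x \<in> {x \<in> K. h x = c0} - range \<xi>"
    then obtain m :: int where m: "x + E x = p0 + of_real (pi * of_int m)" using level by blast
    have "m < int m0"
    proof (rule ccontr)
      assume "\<not> m < int m0"
      then obtain j where "m = int (m0 + j)"
        by (metis linorder_not_less nat_int_comparison(3) nat_le_iff_add zle_iff_zadd of_nat_add)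
      then have "x + E x = \<xi> j + E (\<xi> j)" using m \<xi>(2) by (simp add: p_def)
      then have "cmod (x - \<xi> j) = cmod (E (\<xi> j) - E x)"
        by (metis add_diff_cancel_left' add_diff_eq diff_add_cancel diff_diff_eq2 add.commute)
      also have "\<dots> \<le> c/80 * cmod (x - \<xi> j)"
        using lip[of "\<xi> j" x] x \<xi>(1)[of j] by (simp add: norm_minus_commute)
      also have "\<dots> \<le> 1/2 * cmod (x - \<xi> j)" using c by (intro mult_right_mono) auto
      finally have "x = \<xi> j" by simp
      then show False using x by blast
    qed
    have n: "cmod x \<le> 2 * Re x" using norm_le_wedge[of x "c/2" "2*X"] x c X by (auto simp: K_def)
    have "Re x + Re (E x) = Re p0 + pi * of_int m" using arg_cong[OF m, of Re] by simp
    moreover define A where "A = Re p0 + pi * m0"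
    have "Re p0 + pi * of_int m \<le> A" using \<open>m < int m0\<close> by (simp add: A_def)
    ultimately have "Re x \<le> A + cmod (E x)"
      using abs_Re_le_cmod[of "E x"] by linarith
    moreover have "cmod (E x) \<le> C + c/80 * cmod x" using Ebd x by blast
    moreover have "c/80 * cmod x \<le> cmod x / 4"
      using c mult_right_mono[of "c/80" "1/4" "cmod x"] by simp
    ultimately have "cmod x \<le> 4 * (A + C)" using n by argo
    then show "cmod x \<le> 4 * (Re p0 + pi * m0 + C)" by (simp only: A_def)
  qed
  moreover have "\<exists>a b. 0 < a \<and> 0 < b \<and> (\<forall>m. a * real (Suc m) \<le> cmod (\<xi> m) \<and> cmod (\<xi> m) \<le> b * real (Suc m))"
  proof (intro exI conjI allI)
    fix j
    have d: "cmod (\<xi> j - p j) \<le> c/4 * Re (p j)"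
      using \<xi>(1)[of j] by (simp add: dist_norm norm_minus_commute)
    also have "\<dots> \<le> 1/4 * Re (p j)"
      using pge(1)[of j] c by (intro mult_right_mono) auto
    finally have d: "cmod (\<xi> j - p j) \<le> 1/4 * Re (p j)" .
    have "Re (p j) - Re (\<xi> j) \<le> 1/4 * Re (p j)"
      using d abs_Re_le_cmod[of "\<xi> j - p j"] by simp
    then show "1/2 * real (Suc j) \<le> cmod (\<xi> j)"
      using pge(1)[of j] complex_Re_le_cmod[of "\<xi> j"] of_nat_0_le_iff[of "Suc j", where 'a = real]
      by argo
    have "cmod (p j) \<le> cmod p0 + pi * real (m0 + j)"
      using norm_triangle_ineq[of p0 "of_real (pi * real (m0 + j))"] by (simp only: p_def norm_of_real) simp
    moreover have "cmod (\<xi> j) \<le> 2 * cmod (p j)"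
      using d complex_Re_le_cmod[of "p j"] norm_triangle_sub[of "\<xi> j" "p j"]
        norm_ge_zero[of "p j"] by linarith
    ultimately have "cmod (\<xi> j) \<le> 2 * (cmod p0 + pi * real (m0 + j))" by argo
    also have "\<dots> \<le> (2 * (cmod p0 + pi * (real m0 + 1))) * real (Suc j)"
    proof -
      have "cmod p0 * 1 \<le> cmod p0 * real (Suc j)" by (intro mult_left_mono) auto
      moreover have "pi * real (m0 + j) \<le> pi * ((real m0 + 1) * real (Suc j))"
        by (intro mult_left_mono) (auto simp: algebra_simps)
      ultimately show ?thesis by (simp add: algebra_simps)
    qed
    finally show "cmod (\<xi> j) \<le> (2 * (cmod p0 + pi * (real m0 + 1))) * real (Suc j)" .
  qed (auto intro!: add_nonneg_pos mult_pos_pos)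
  ultimately show ?thesis
    using inj ran part1 unfolding K_def by blast
qed

section \<open>Straightening the sectors\<close>

text \<open>With principal powers this is z = d + e^(i \<theta>) (x / \<beta>)^\<nu>, and
  \<open>cochart\<close> is x = \<beta> ((z - d) e^(-i \<theta>))^(1/\<nu>). In the application
  \<nu> = 2/(N+2) and \<beta> = 2 sqrt |b| / (N+2); this choice makes the exponents of the two
  solutions equal to i (-1)^k x and its negative, up to the factor 1 + o(1).\<close>

definition chart :: "complex \<Rightarrow> real \<Rightarrow> real \<Rightarrow> real \<Rightarrow> complex \<Rightarrow> complex" where
  "chart d \<theta> \<beta> \<nu> x = d + cis \<theta> * exp (of_real \<nu> * (Ln x - of_real (ln \<beta>)))"

definition cochart :: "complex \<Rightarrow> real \<Rightarrow> real \<Rightarrow> real \<Rightarrow> complex \<Rightarrow> complex" where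
  "cochart d \<theta> \<beta> \<nu> z = exp (of_real (ln \<beta>) + Ln ((z - d) * cis (- \<theta>)) / of_real \<nu>)"

lemma abs_Arg_le_wedge:
  assumes "x \<in> wedge c X" "0 \<le> X"
  shows "\<bar>Arg x\<bar> < c" "\<bar>Arg x\<bar> < pi / 2" "Im (Ln x) = Arg x" "x \<noteq> 0"
proof -
  have x: "0 < Re x" "\<bar>Im x\<bar> < c * Re x" using assms by (auto simp: wedge_def)
  then show "x \<noteq> 0" by auto
  then show ImLn: "Im (Ln x) = Arg x" by (simp add: Arg_eq_Im_Ln)
  have "Arg x = arctan (Im x / Re x)" using x by (intro arg_conv_arctan)
  then have "\<bar>Arg x\<bar> \<le> \<bar>Im x / Re x\<bar>" using abs_arctan_le by metis
  also have "\<dots> < c" using x by (simp add: abs_divide divide_simps)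
  finally show "\<bar>Arg x\<bar> < c" .
  show "\<bar>Arg x\<bar> < pi / 2" using x(1) \<open>x \<noteq> 0\<close> Re_Ln_pos_lt[of x] ImLn by simp
qed

context
  fixes d :: complex and \<theta> \<beta> \<nu> :: real
  assumes \<beta>: "0 < \<beta>" and \<nu>: "0 < \<nu>" "\<nu> \<le> 1"
begin

text \<open>On the wedge |Arg x| < pi/2, and \<nu> <= 1 only shrinks it, so the exponent lies in the
  principal strip and \<open>Ln\<close> undoes \<open>exp\<close>.\<close>

lemma Ln_chart:
  assumes "x \<in> wedge c X" "0 \<le> X"
  shows "Ln ((chart d \<theta> \<beta> \<nu> x - d) * cis (- \<theta>)) = of_real \<nu> * (Ln x - of_real (ln \<beta>))"
proof -
  have "(chart d \<theta> \<beta> \<nu> x - d) * cis (- \<theta>) = exp (of_real \<nu> * (Ln x - of_real (ln \<beta>)))"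
    by (simp add: chart_def cis_mult mult.commute flip: mult.assoc)
  moreover have "\<bar>\<nu> * Im (Ln x)\<bar> < pi"
  proof -
    have "\<nu> * \<bar>Im (Ln x)\<bar> \<le> 1 * \<bar>Im (Ln x)\<bar>" using \<nu> by (intro mult_right_mono) auto
    then show ?thesis using abs_Arg_le_wedge[OF assms] \<nu> pi_gt_zero by (simp add: abs_mult)
  qed
  ultimately show ?thesis by (simp add: Ln_exp)
qed

lemma cochart_chart:
  assumes "x \<in> wedge c X" "0 \<le> X"
  shows "cochart d \<theta> \<beta> \<nu> (chart d \<theta> \<beta> \<nu> x) = x"
  unfolding cochart_def Ln_chart[OF assms] using \<nu> abs_Arg_le_wedge(4)[OF assms] by simp

lemma cmod_chart:
  assumes "x \<noteq> 0"
  shows "cmod (chart d \<theta> \<beta> \<nu> x - d) = (cmod x / \<beta>) powr \<nu>"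
  using assms \<beta> by (simp add: chart_def norm_mult powr_def ln_div)

lemma cmod_cochart:
  assumes "z \<noteq> d"
  shows "cmod (cochart d \<theta> \<beta> \<nu> z) = \<beta> * cmod (z - d) powr (1 / \<nu>)"
  using assms \<beta> by (simp add: cochart_def powr_def exp_add norm_mult)

text \<open>In this direction arguments are divided by \<nu> <= 1 and grow; the bound pi * \<nu> is
  what keeps the result inside the principal strip.\<close>

lemma Arg_cochart:
  assumes z: "z \<noteq> d" and A: "\<bar>Arg ((z - d) * cis (- \<theta>))\<bar> < pi * \<nu>"
  shows "Ln (cochart d \<theta> \<beta> \<nu> z) = of_real (ln \<beta>) + Ln ((z - d) * cis (- \<theta>)) / of_real \<nu>"
    "Arg (cochart d \<theta> \<beta> \<nu> z) = Arg ((z - d) * cis (- \<theta>)) / \<nu>"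
    "chart d \<theta> \<beta> \<nu> (cochart d \<theta> \<beta> \<nu> z) = z"
proof -
  let ?m = "(z - d) * cis (- \<theta>)"
  have m: "?m \<noteq> 0" using z by simp
  have "\<bar>Arg ?m / \<nu>\<bar> < pi" using A \<nu> by (simp add: abs_divide divide_simps)
  then have b: "- pi < Arg ?m / \<nu>" "Arg ?m / \<nu> \<le> pi" by linarith+
  have I: "Im (of_real (ln \<beta>) + Ln ?m / of_real \<nu>) = Arg ?m / \<nu>"
    using m by (simp add: Arg_eq_Im_Ln)
  show L: "Ln (cochart d \<theta> \<beta> \<nu> z) = of_real (ln \<beta>) + Ln ?m / of_real \<nu>"
    unfolding cochart_def by (rule Ln_exp) (use I b in auto)
  have "cochart d \<theta> \<beta> \<nu> z \<noteq> 0" by (simp add: cochart_def)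
  then show "Arg (cochart d \<theta> \<beta> \<nu> z) = Arg ?m / \<nu>" using L I by (simp add: Arg_eq_Im_Ln)
  show "chart d \<theta> \<beta> \<nu> (cochart d \<theta> \<beta> \<nu> z) = z"
    unfolding chart_def L using \<nu> m by (simp add: cis_mult mult.commute flip: mult.assoc)
qed

lemma DERIV_chart:
  assumes "x \<in> wedge c X" "0 \<le> X"
  shows "(chart d \<theta> \<beta> \<nu> has_field_derivative (of_real \<nu> * (chart d \<theta> \<beta> \<nu> x - d) / x)) (at x)"
proof -
  have "x \<notin> \<real>\<^sub>\<le>\<^sub>0" using assms by (auto simp: wedge_def complex_nonpos_Reals_iff)
  then show ?thesis
    unfolding chart_def using abs_Arg_le_wedge(4)[OF assms]
    by (auto intro!: derivative_eq_intros simp: field_simps)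
qed

end

section \<open>The sectors in polar form and the exponent in the straightened variable\<close>

lemma theta_neighbours:
  "theta P Q (k + 1) = theta P Q k + 2 * pi / (real (gap P Q) + 2)"
  "theta P Q (k - 1) = theta P Q k - 2 * pi / (real (gap P Q) + 2)"
  by (simp_all add: theta_def ring_distribs add_divide_distrib diff_divide_distrib)

text \<open>The sector is symmetric about the ray with argument theta k, and its half-opening 2
  pi/(N+2) - \<delta> is below pi even for N = 0. So the angle in the definition, once rotated by
  -theta k, is the principal argument.\<close>

lemma sector_eq:
  assumes r: "0 < r" and \<delta>: "0 < \<delta>"
  shows "sector P Q k r \<delta> = {z. r < cmod (z - centre P Q) \<and>
    \<bar>Arg ((z - centre P Q) * cis (- theta P Q k))\<bar> < pi * (2 / (real (gap P Q) + 2)) - \<delta>}"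
proof -
  let ?\<omega> = "2 * pi / (real (gap P Q) + 2) - \<delta>"
  have \<omega>: "?\<omega> < pi"
    using \<delta> pi_gt_zero by (simp add: field_simps) (smt (verit) mult_nonneg_nonneg of_nat_0_le_iff pi_ge_zero mult_pos_pos)
  have "(\<exists>\<phi>. theta P Q (k - 1) + \<delta> < \<phi> \<and> \<phi> < theta P Q (k + 1) - \<delta> \<and>
              z - centre P Q = of_real (cmod (z - centre P Q)) * cis \<phi>) \<longleftrightarrow>
      \<bar>Arg ((z - centre P Q) * cis (- theta P Q k))\<bar> < ?\<omega>"
    (is "?L \<longleftrightarrow> ?R") if z: "r < cmod (z - centre P Q)" for z
  proof
    assume ?L
    then obtain \<phi> where \<phi>: "theta P Q (k - 1) + \<delta> < \<phi>" "\<phi> < theta P Q (k + 1) - \<delta>"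
      "z - centre P Q = of_real (cmod (z - centre P Q)) * cis \<phi>" by blast
    have b: "\<bar>\<phi> - theta P Q k\<bar> < ?\<omega>" using \<phi>(1,2) by (auto simp: theta_neighbours abs_less_iff)
    have "(z - centre P Q) * cis (- theta P Q k) = rcis (cmod (z - centre P Q)) (\<phi> - theta P Q k)"
      by (subst \<phi>(3)) (simp add: rcis_def cis_mult mult.assoc)
    then have "Arg ((z - centre P Q) * cis (- theta P Q k)) = \<phi> - theta P Q k"
      using z r b \<omega> by (intro Arg_unique') auto
    then show ?R using b by simp
  next
    assume R: ?R
    let ?m = "(z - centre P Q) * cis (- theta P Q k)"
    have "z - centre P Q = ?m * cis (theta P Q k)" by (simp add: cis_mult mult.assoc)
    also have "?m = rcis (cmod ?m) (Arg ?m)" by (simp add: rcis_cmod_Arg)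
    finally have "z - centre P Q = of_real (cmod (z - centre P Q)) * cis (theta P Q k + Arg ?m)"
      by (simp add: rcis_def norm_mult cis_mult mult.assoc add.commute)
    then show ?L using R by (intro exI[of _ "theta P Q k + Arg ?m"]) (auto simp: theta_neighbours)
  qed
  then show ?thesis unfolding sector_def by (auto simp: mult.commute)
qed

text \<open>The principal argument jumps across the negative axis, which the rotated sector avoids
  because its half-opening is below pi.\<close>

lemma open_sector:
  assumes r: "0 < r" and \<delta>: "0 < \<delta>"
  shows "open (sector P Q k r \<delta>)"
proof -
  let ?m = "\<lambda>z. (z - centre P Q) * cis (- theta P Q k)"
  let ?\<omega> = "pi * (2 / (real (gap P Q) + 2)) - \<delta>"
  have \<omega>: "?\<omega> < pi"
    using \<delta> pi_gt_zero by (simp add: field_simps) (smt (verit) mult_nonneg_nonneg of_nat_0_le_iff pi_ge_zero mult_pos_pos)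
  define U where "U = ?m -` (- \<real>\<^sub>\<le>\<^sub>0)"
  have oU: "open U" unfolding U_def
    by (intro open_vimage continuous_intros) auto
  have "continuous_on U (\<lambda>z. Arg (?m z))"
    by (rule continuous_on_compose2[OF continuous_on_Arg]) (auto simp: U_def intro!: continuous_intros)
  then have "open (U \<inter> (\<lambda>z. Arg (?m z)) -` {-?\<omega> <..< ?\<omega>})"
    by (intro continuous_open_preimage oU) auto
  moreover have "open {z. r < cmod (z - centre P Q)}"
    by (intro open_Collect_less continuous_intros)
  moreover have "sector P Q k r \<delta> =
      (U \<inter> (\<lambda>z. Arg (?m z)) -` {-?\<omega> <..< ?\<omega>}) \<inter> {z. r < cmod (z - centre P Q)}"
  proof -
    have "?m z \<notin> \<real>\<^sub>\<le>\<^sub>0" if "\<bar>Arg (?m z)\<bar> < ?\<omega>" "r < cmod (z - centre P Q)" for z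
    proof
      assume "?m z \<in> \<real>\<^sub>\<le>\<^sub>0"
      moreover have "?m z \<noteq> 0" using that r by auto
      ultimately have "Arg (?m z) = pi"
        by (metis Arg_eq_pi complex_nonpos_Reals_iff complex_eq_iff less_eq_real_def zero_complex.simps)
      then show False using that \<omega> by simp
    qed
    then show ?thesis unfolding sector_eq[OF assms] U_def by auto
  qed
  ultimately show ?thesis by (simp only: open_Int)
qed

text \<open>The definition of theta gives (N+2)/2 * theta k = pi k - (Arg b)/2. The second term
  cancels the argument of sqrt b, the first leaves the real sign (-1)^k, written cos (pi k), and
  \<beta> absorbs 2 sqrt |b| / (N+2).\<close>

lemma asymptotic_exponent:
  fixes P Q :: "complex poly" and k :: int
  assumes "Q \<noteq> 0"
  defines "\<beta> \<equiv> 2 * sqrt (cmod (lead_coeff Q)) / (real (gap P Q) + 2)"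
    and "\<nu> \<equiv> 2 / (real (gap P Q) + 2)"
  shows "(2 * \<i> * csqrt (lead_coeff Q) / (of_nat (gap P Q) + 2))
      * sector_pow P Q k z ((of_nat (gap P Q) + 2) / 2)
    = \<i> * of_real (cos (pi * of_int k)) * cochart (centre P Q) (theta P Q k) \<beta> \<nu> z"
proof -
  let ?n = "real (gap P Q) + 2"
  let ?b = "lead_coeff Q"
  let ?m = "(z - centre P Q) * cis (- theta P Q k)"
  have n: "?n > 0" by linarith
  have b: "?b \<noteq> 0" using assms(1) by simp
  have nc: "of_nat (gap P Q) + 2 = (of_real ?n :: complex)" by simp
  have \<beta>: "0 < \<beta>" using b n unfolding \<beta>_def by (intro divide_pos_pos) auto
  have lb: "Ln ?b = of_real (ln (cmod ?b)) + \<i> * of_real (Arg ?b)"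
    using b by (simp add: complex_eq_iff Arg_eq_Im_Ln)
  have th: "of_real ?n * of_real (theta P Q k) = (of_real (2 * pi * of_int k - Arg ?b) :: complex)"
    unfolding theta_def of_real_mult[symmetric] using n by (simp del: of_real_diff of_real_mult)
  have ek: "exp (\<i> * of_real (pi * of_int k)) = (of_real (cos (pi * of_int k)) :: complex)"
    unfolding cis_conv_exp[symmetric] by (simp add: complex_eq_iff mult.commute sin_integer_2pi)
  have e\<beta>: "exp (of_real (ln \<beta>)) = of_real (2 / ?n) * exp (of_real (ln (cmod ?b) / 2) :: complex)"
  proof -
    have "exp (ln (cmod ?b) / 2) = sqrt (cmod ?b)"
      using b by (simp add: powr_def[symmetric] powr_half_sqrt[symmetric] powr_def)
    then have "\<beta> = 2 / ?n * exp (ln (cmod ?b) / 2)" by (simp add: \<beta>_def)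
    then show ?thesis using \<beta> by (metis exp_ln exp_of_real of_real_mult)
  qed
  have "csqrt ?b * sector_pow P Q k z ((of_nat (gap P Q) + 2) / 2)
      = exp (Ln ?b / 2 + of_real ?n / 2 * (Ln ?m + \<i> * of_real (theta P Q k)))"
    unfolding sector_pow_def nc csqrt_exp_Ln[OF b] by (simp only: exp_add mult_ac)
  also have "Ln ?b / 2 + of_real ?n / 2 * (Ln ?m + \<i> * of_real (theta P Q k))
      = of_real (ln (cmod ?b) / 2) + \<i> * of_real (pi * of_int k) + of_real ?n / 2 * Ln ?m"
  proof -
    have *: "of_real ?n / 2 * (Ln ?m + \<i> * of_real (theta P Q k))
      = of_real ?n / 2 * Ln ?m + \<i> * (of_real ?n * of_real (theta P Q k)) / 2"
      by (simp only: distrib_left mult_ac times_divide_eq_right times_divide_eq_left)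
    show ?thesis unfolding * th lb
      by (simp add: add_divide_distrib diff_divide_distrib right_diff_distrib)
  qed
  also have "of_real ?n / 2 * Ln ?m = Ln ?m / of_real \<nu>"
    unfolding \<nu>_def using n by (simp add: field_simps)
  finally have *: "csqrt ?b * sector_pow P Q k z ((of_nat (gap P Q) + 2) / 2)
      = exp (of_real (ln (cmod ?b) / 2)) * of_real (cos (pi * of_int k)) * exp (Ln ?m / of_real \<nu>)"
    by (simp only: exp_add ek)
  have "(2 * \<i> * csqrt ?b / (of_nat (gap P Q) + 2)) * sector_pow P Q k z ((of_nat (gap P Q) + 2) / 2)
      = \<i> * of_real (2 / ?n) * (csqrt ?b * sector_pow P Q k z ((of_nat (gap P Q) + 2) / 2))"
    unfolding nc using n by (simp add: field_simps)
  then show ?thesis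
    unfolding * cochart_def exp_add e\<beta> by (simp only: mult_ac)
qed

section \<open>Asymptotic pairs\<close>

text \<open>Far out, the relative error in the exponent costs at most e/2 * |x|, and the bounded
  factor 1 + \<eta> costs at most 1, which is again below e/2 * |x|. The logarithm from the power of
  z - d is kept exactly, so that it cancels in a quotient.\<close>

lemma asymptotic_log_modulus:
  fixes P Q :: "complex poly" and k :: int
  assumes Q: "Q \<noteq> 0" and form: "has_asymptotic_form P Q k r \<delta> (of_real \<sigma>) f"
    and \<sigma>: "\<bar>\<sigma>\<bar> = 1" and e: "0 < e"
  defines "\<beta> \<equiv> 2 * sqrt (cmod (lead_coeff Q)) / (real (gap P Q) + 2)"
    and "\<nu> \<equiv> 2 / (real (gap P Q) + 2)"
  defines "\<kappa> \<equiv> cochart (centre P Q) (theta P Q k) \<beta> \<nu>"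
  shows "\<forall>\<^sub>F z in inf at_infinity (principal (sector P Q k r \<delta>)). f z \<noteq> 0 \<and>
    \<bar>ln (cmod (f z)) - (3 * real (degree P) - real (degree Q)) / 4 * ln (cmod (z - centre P Q))
       + \<sigma> * cos (pi * of_int k) * Im (\<kappa> z)\<bar> \<le> e * cmod (\<kappa> z)"
proof -
  let ?d = "centre P Q" and ?F = "inf at_infinity (principal (sector P Q k r \<delta>))"
  let ?s = "cos (pi * of_int k)"
  define q where "q = (3 * real (degree P) - real (degree Q)) / 4"
  obtain \<epsilon> \<eta> where \<epsilon>: "(\<epsilon> \<longlongrightarrow> 0) ?F" and \<eta>: "\<eta> \<in> O[?F](\<lambda>z. inverse (z - ?d))"
    and f: "\<forall>\<^sub>F z in ?F. f z =
           sector_pow P Q k z ((3 * of_nat (degree P) - of_nat (degree Q)) / 4)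
           * exp (of_real \<sigma> * (2 * \<i> * csqrt (lead_coeff Q) / (of_nat (gap P Q) + 2))
                  * sector_pow P Q k z ((of_nat (gap P Q) + 2) / 2) * (1 + \<epsilon> z))
           * (1 + \<eta> z)"
    using form unfolding has_asymptotic_form_def Let_def by blast
  obtain B where B: "\<forall>\<^sub>F z in ?F. cmod (\<eta> z) \<le> B * cmod (inverse (z - ?d))"
    using \<eta> by (auto elim: landau_o.bigE)
  have \<beta>: "0 < \<beta>" unfolding \<beta>_def using Q by (intro divide_pos_pos) auto
  have \<nu>: "0 < \<nu>" "\<nu> \<le> 1" unfolding \<nu>_def by auto
  \<comment> \<open>Beyond 2 |B| the term \<eta> is at most 1/2. Beyond 2 / (e \<beta>) one has |x|
    >= \<beta> |z - d| >= 2/e, which absorbs the constant 1; here |z - d| >= 1 is used to drop the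
    exponent 1/\<nu>.\<close>
  define R where "R = 1 + 2 * \<bar>B\<bar> + 2 / (e * \<beta>)"
  have R: "R \<ge> 1" "R \<ge> 2 * \<bar>B\<bar>" "R \<ge> 2 / (e * \<beta>)" using e \<beta> by (auto simp: R_def)
  have "\<forall>\<^sub>F z in at_infinity. R \<le> cmod (z - ?d)"
    unfolding eventually_at_infinity
  proof (intro exI allI impI)
    fix z assume "R + cmod ?d \<le> cmod z"
    then show "R \<le> cmod (z - ?d)" using norm_triangle_ineq2[of z ?d] by linarith
  qed
  then have far: "\<forall>\<^sub>F z in ?F. R \<le> cmod (z - ?d)"
    by (rule filter_leD[OF inf_le1])
  have "\<forall>\<^sub>F z in ?F. cmod (\<epsilon> z) < e / 2"
    using tendstoD[OF \<epsilon>, of "e / 2"] e by simp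
  then show ?thesis
    using f B far
  proof eventually_elim
    fix z
    assume \<epsilon>z: "cmod (\<epsilon> z) < e / 2"
      and fz: "f z = sector_pow P Q k z ((3 * of_nat (degree P) - of_nat (degree Q)) / 4)
           * exp (of_real \<sigma> * (2 * \<i> * csqrt (lead_coeff Q) / (of_nat (gap P Q) + 2))
                  * sector_pow P Q k z ((of_nat (gap P Q) + 2) / 2) * (1 + \<epsilon> z))
           * (1 + \<eta> z)"
      and Bz: "cmod (\<eta> z) \<le> B * cmod (inverse (z - ?d))" and z: "R \<le> cmod (z - ?d)"
    have zd: "z \<noteq> ?d" using z R by auto
    have "cmod (\<eta> z) \<le> 1/2"
    proof -
      have "B * cmod (inverse (z - ?d)) \<le> \<bar>B\<bar> * inverse (cmod (z - ?d))"
        by (simp add: norm_inverse mult_right_mono)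
      also have "\<dots> \<le> 1/2" using z R zd by (simp add: divide_simps)
      finally show ?thesis using Bz by linarith
    qed
    then have n\<eta>: "1/2 \<le> cmod (1 + \<eta> z)" "cmod (1 + \<eta> z) \<le> 3/2"
      using norm_triangle_ineq[of 1 "\<eta> z"] norm_diff_ineq[of 1 "\<eta> z"] by auto
    then have \<eta>0: "1 + \<eta> z \<noteq> 0" by auto
    have ln\<eta>: "\<bar>ln (cmod (1 + \<eta> z))\<bar> \<le> 1"
    proof -
      have "ln (cmod (1 + \<eta> z)) \<le> cmod (1 + \<eta> z) - 1" using n\<eta> by (intro ln_le_minus_one) auto
      moreover have "- ln (cmod (1 + \<eta> z)) \<le> inverse (cmod (1 + \<eta> z)) - 1"
        using \<eta>0 ln_le_minus_one[of "inverse (cmod (1 + \<eta> z))"] by (simp add: ln_inverse)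
      moreover have "inverse (cmod (1 + \<eta> z)) \<le> inverse (1/2)"
        using n\<eta> by (intro le_imp_inverse_le) auto
      ultimately show ?thesis using n\<eta> by simp
    qed
    define w where "w = of_real \<sigma> * (\<i> * of_real ?s * \<kappa> z)"
    have pow: "sector_pow P Q k z ((3 * of_nat (degree P) - of_nat (degree Q)) / 4)
        = exp (of_real q * (Ln ((z - ?d) * cis (- theta P Q k)) + \<i> * of_real (theta P Q k)))"
      by (simp add: sector_pow_def q_def)
    have fz': "f z = exp (of_real q * (Ln ((z - ?d) * cis (- theta P Q k)) + \<i> * of_real (theta P Q k)))
          * exp (w * (1 + \<epsilon> z)) * (1 + \<eta> z)"
      unfolding fz pow w_def \<kappa>_def \<beta>_def \<nu>_def asymptotic_exponent[OF Q, symmetric]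
      by (simp only: mult.assoc)
    have nz: "f z \<noteq> 0" unfolding fz' using \<eta>0 by simp
    have "cmod (f z) = exp (q * ln (cmod (z - ?d))) * exp (Re (w * (1 + \<epsilon> z))) * cmod (1 + \<eta> z)"
      unfolding fz' using zd by (simp add: norm_mult)
    then have "ln (cmod (f z)) = q * ln (cmod (z - ?d)) + Re (w * (1 + \<epsilon> z)) + ln (cmod (1 + \<eta> z))"
      using \<eta>0 by (simp add: ln_mult)
    moreover have "Re (w * (1 + \<epsilon> z)) = - (\<sigma> * ?s * Im (\<kappa> z)) + Re (w * \<epsilon> z)"
      by (simp add: w_def distrib_left)
    moreover have "\<bar>Re (w * \<epsilon> z)\<bar> \<le> e / 2 * cmod (\<kappa> z)"
    proof -
      have "\<bar>?s\<bar> = 1" by simp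
      then have "cmod w = cmod (\<kappa> z)" using \<sigma> by (simp only: w_def norm_mult norm_of_real) simp
      then have "cmod (w * \<epsilon> z) \<le> cmod (\<kappa> z) * (e / 2)"
        unfolding norm_mult using \<epsilon>z by (intro mult_mono) auto
      then show ?thesis using abs_Re_le_cmod[of "w * \<epsilon> z"] by (simp add: mult.commute)
    qed
    moreover have "1 \<le> e / 2 * cmod (\<kappa> z)"
    proof -
      have "cmod (\<kappa> z) = \<beta> * cmod (z - ?d) powr (1 / \<nu>)"
        unfolding \<kappa>_def using cmod_cochart[OF \<beta> \<nu> zd] .
      moreover have "cmod (z - ?d) powr 1 \<le> cmod (z - ?d) powr (1 / \<nu>)"
        using z R \<nu> by (intro powr_mono) auto
      ultimately have "\<beta> * cmod (z - ?d) \<le> cmod (\<kappa> z)"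
        using \<beta> zd by simp
      moreover have "2 / (e * \<beta>) \<le> cmod (z - ?d)" using z R by linarith
      then have "2 / e \<le> \<beta> * cmod (z - ?d)" using e \<beta> by (simp add: field_simps)
      ultimately have "2 / e \<le> cmod (\<kappa> z)" by linarith
      then show ?thesis using e by (simp add: field_simps)
    qed
    ultimately have "\<bar>ln (cmod (f z)) - q * ln (cmod (z - ?d)) + \<sigma> * ?s * Im (\<kappa> z)\<bar>
        \<le> e / 2 * cmod (\<kappa> z) + e / 2 * cmod (\<kappa> z)"
      using ln\<eta> by linarith
    then show "f z \<noteq> 0 \<and> \<bar>ln (cmod (f z)) - (3 * real (degree P) - real (degree Q)) / 4 * ln (cmod (z - ?d))
        + \<sigma> * ?s * Im (\<kappa> z)\<bar> \<le> e * cmod (\<kappa> z)"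
      using nz by (simp add: q_def)
  qed
qed

text \<open>Both solutions carry the same power of z - d, which cancels, while the opposite signs in
  the exponents double the term in Im x. Each of them uses up e/2 of the permitted error.\<close>

lemma asymptotic_pair_log_quotient:
  fixes P Q :: "complex poly" and k :: int
  assumes Q: "Q \<noteq> 0" and pair: "asymptotic_pair P Q k r \<delta> gp gm" and e: "0 < e"
  defines "\<beta> \<equiv> 2 * sqrt (cmod (lead_coeff Q)) / (real (gap P Q) + 2)"
    and "\<nu> \<equiv> 2 / (real (gap P Q) + 2)"
  defines "\<kappa> \<equiv> cochart (centre P Q) (theta P Q k) \<beta> \<nu>"
  obtains R where "\<And>z. z \<in> sector P Q k r \<delta> \<Longrightarrow> R \<le> cmod z \<Longrightarrow> gp z \<noteq> 0 \<and> gm z \<noteq> 0 \<and>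
    \<bar>ln (cmod (gp z / gm z)) + 2 * cos (pi * of_int k) * Im (\<kappa> z)\<bar> \<le> e * cmod (\<kappa> z)"
proof -
  let ?F = "inf at_infinity (principal (sector P Q k r \<delta>))"
  let ?s = "cos (pi * of_int k)"
  have "has_asymptotic_form P Q k r \<delta> (of_real 1) gp" "has_asymptotic_form P Q k r \<delta> (of_real (-1)) gm"
    using pair by (simp_all add: asymptotic_pair_def)
  note form = this
  have "\<bar>1 :: real\<bar> = 1" "\<bar>-1 :: real\<bar> = 1" "0 < e / 2" using e by auto
  note 1 = asymptotic_log_modulus[OF Q form(1) this(1) this(3)]
    and 2 = asymptotic_log_modulus[OF Q form(2) this(2) this(3)]
  have "\<forall>\<^sub>F z in ?F. gp z \<noteq> 0 \<and> gm z \<noteq> 0 \<and>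
    \<bar>ln (cmod (gp z / gm z)) + 2 * ?s * Im (\<kappa> z)\<bar> \<le> e * cmod (\<kappa> z)"
    using 1[folded \<nu>_def, folded \<beta>_def, folded \<kappa>_def] 2[folded \<nu>_def, folded \<beta>_def, folded \<kappa>_def]
  proof eventually_elim
    case (elim z)
    define l where "l = (3 * real (degree P) - real (degree Q)) / 4 * ln (cmod (z - centre P Q))"
    define u where "u = ?s * Im (\<kappa> z)"
    define v where "v = e * cmod (\<kappa> z)"
    have nz: "gp z \<noteq> 0" "gm z \<noteq> 0" using elim e by auto
    have "\<bar>ln (cmod (gp z)) - l + u\<bar> \<le> v / 2" "\<bar>ln (cmod (gm z)) - l - u\<bar> \<le> v / 2"
      using elim e by (simp_all add: l_def u_def v_def)
    moreover have "ln (cmod (gp z / gm z)) = ln (cmod (gp z)) - ln (cmod (gm z))"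
      using nz by (simp add: norm_divide ln_div)
    ultimately have "\<bar>ln (cmod (gp z / gm z)) + 2 * u\<bar> \<le> v" by argo
    then show ?case using nz by (simp only: u_def v_def mult.assoc simp_thms not_False_eq_True)
  qed
  then show ?thesis
    unfolding eventually_inf_principal eventually_at_infinity using that by blast
qed

text \<open>The coefficient -P'/P of the first derivative makes the Wronskian W satisfy W' = (P'/P)
  W. The pointwise form lets W/P be composed with \<open>chart\<close> and declared constant on the
  convex wedge.\<close>

lemma wronskian_derivative:
  assumes S: "open S" and z: "z \<in> S" and P: "poly P z \<noteq> 0"
    and f1: "solves_ode_on P Q S f1" and f2: "solves_ode_on P Q S f2"
  shows "((\<lambda>z. (f1 z * deriv f2 z - deriv f1 z * f2 z) / poly P z) has_field_derivative 0) (at z)"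
proof -
  have hol: "f1 holomorphic_on S" "f2 holomorphic_on S"
    using f1 f2 by (auto simp: solves_ode_on_def)
  have d: "(f1 has_field_derivative deriv f1 z) (at z)" "(f2 has_field_derivative deriv f2 z) (at z)"
    "(deriv f1 has_field_derivative deriv (deriv f1) z) (at z)"
    "(deriv f2 has_field_derivative deriv (deriv f2) z) (at z)"
    using hol S z by (auto intro!: holomorphic_derivI holomorphic_deriv)
  have o: "deriv (deriv f1) z = poly (pderiv P) z / poly P z * deriv f1 z - poly Q z / poly P z * f1 z"
    "deriv (deriv f2) z = poly (pderiv P) z / poly P z * deriv f2 z - poly Q z / poly P z * f2 z"
    using f1 f2 z P unfolding solves_ode_on_def by (simp_all add: algebra_simps)
  show ?thesis
    by (rule derivative_eq_intros d poly_DERIV P refl | simp only: o)+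
      (use P in \<open>simp add: field_simps\<close>)
qed

section \<open>Zeros in a Stokes sector\<close>

text \<open>If Re x <= 0, then |Arg x| lies in [pi/2, \<omega>), where the sine decreases, so |Im x|
  = |x| sin |Arg x| would exceed |x| sin \<omega>.\<close>

lemma sin_lt_imp_Re_pos:
  assumes x: "x \<noteq> 0" and \<omega>: "\<bar>Arg x\<bar> < \<omega>" "\<omega> < pi" and im: "\<bar>Im x\<bar> < sin \<omega> * cmod x"
  shows "0 < Re x"
proof (rule ccontr)
  assume "\<not> 0 < Re x"
  then have "pi / 2 \<le> \<bar>Arg x\<bar>" using Arg_Re_pos[of x] x by linarith
  then have "cos (\<omega> - pi / 2) < cos (\<bar>Arg x\<bar> - pi / 2)"
    using \<omega> by (intro cos_monotone_0_pi) auto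
  then have "sin \<omega> < sin \<bar>Arg x\<bar>" by (simp add: cos_diff)
  also have "\<dots> = \<bar>sin (Arg x)\<bar>"
    using \<omega> sin_ge_zero[of "Arg x"] sin_ge_zero[of "- Arg x"] by (cases "0 \<le> Arg x") auto
  finally have "sin \<omega> * cmod x < \<bar>sin (Arg x)\<bar> * cmod x" using x by simp
  also have "\<dots> = \<bar>Im (rcis (cmod x) (Arg x))\<bar>" by (simp add: abs_mult)
  also have "\<dots> = \<bar>Im x\<bar>" by (simp only: rcis_cmod_Arg)
  finally show False using im by simp
qed

text \<open>This confines far zeros to the narrow wedge. A small |Im x| / |x| first excludes the
  left half-plane; then |x| <= 2 Re x, and c/8 * |x| becomes c/4 * Re x.\<close>

lemma near_axis_in_wedge:
  assumes \<omega>: "\<bar>Arg x\<bar> < \<omega>" "\<omega> < pi" and c: "0 < c" "c \<le> 1"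
    and e: "e < sin \<omega>" "e \<le> c / 8" and im: "\<bar>Im x\<bar> \<le> e * cmod x" and big: "2 * Y < cmod x" and Y: "0 \<le> Y"
  shows "x \<in> wedge (c / 2) Y"
proof -
  have x: "x \<noteq> 0" "0 < cmod x" using big Y by auto
  have "e * cmod x < sin \<omega> * cmod x" using e x by simp
  then have Re: "0 < Re x" using sin_lt_imp_Re_pos[OF x(1) \<omega>] im by simp
  have "e * cmod x \<le> c / 8 * cmod x" using e x by (intro mult_right_mono) auto
  then have im': "\<bar>Im x\<bar> \<le> c / 8 * cmod x" using im by linarith
  moreover have "c / 8 * cmod x \<le> 1 / 8 * cmod x" using c by (intro mult_right_mono) auto
  ultimately have "cmod x \<le> 2 * Re x" using cmod_le[of x] Re by argo
  then have "c / 8 * cmod x \<le> c / 8 * (2 * Re x)" using c by (intro mult_left_mono) auto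
  moreover have "0 < c * Re x" using c Re by simp
  ultimately have "\<bar>Im x\<bar> < c / 2 * Re x" using im' by argo
  then show ?thesis using \<open>cmod x \<le> 2 * Re x\<close> big by (simp add: wedge_def)
qed

text \<open>At a zero of g the relation l2 f2 = - l1 f1 gives f2 g' = - l1 C P, while (f1/f2)' = - C
  P / f2^2. In P / g'^2 both P and the unknown value of f2 are absorbed into this
  derivative.\<close>

lemma residue_coeff_eq:
  assumes S: "open S" "z \<in> S"
    and hol: "f1 holomorphic_on S" "f2 holomorphic_on S"
    and g: "\<And>z. z \<in> S \<Longrightarrow> g z = l1 * f1 z + l2 * f2 z" and gz: "g z = 0" and l1: "l1 \<noteq> 0"
    and nz: "f2 z \<noteq> 0" and P: "poly P z \<noteq> 0" and C: "C \<noteq> 0"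
    and W: "f1 z * deriv f2 z - deriv f1 z * f2 z = C * poly P z"
  shows "deriv (\<lambda>z. f1 z / f2 z) z \<noteq> 0"
    and "residue_coeff P g z = - 1 / (l1\<^sup>2 * C * deriv (\<lambda>z. f1 z / f2 z) z)"
proof -
  have d: "(f1 has_field_derivative deriv f1 z) (at z)" "(f2 has_field_derivative deriv f2 z) (at z)"
    using hol S by (auto intro!: holomorphic_derivI)
  have "((\<lambda>z. f1 z / f2 z) has_field_derivative
      (deriv f1 z * f2 z - f1 z * deriv f2 z) / (f2 z * f2 z)) (at z)"
    by (rule DERIV_divide[OF d nz])
  then have D: "deriv (\<lambda>z. f1 z / f2 z) z = - (C * poly P z) / (f2 z)\<^sup>2"
    by (simp add: DERIV_imp_deriv W[symmetric] power2_eq_square)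
  then show "deriv (\<lambda>z. f1 z / f2 z) z \<noteq> 0" using C P nz by simp
  have "((\<lambda>z. l1 * f1 z + l2 * f2 z) has_field_derivative l1 * deriv f1 z + l2 * deriv f2 z) (at z)"
    by (intro DERIV_add DERIV_cmult d)
  then have "(g has_field_derivative l1 * deriv f1 z + l2 * deriv f2 z) (at z)"
    by (rule has_field_derivative_transform_within_open[OF _ S]) (simp add: g)
  then have dg: "deriv g z = l1 * deriv f1 z + l2 * deriv f2 z" by (rule DERIV_imp_deriv)
  have e: "l2 * f2 z = - (l1 * f1 z)" using g[OF S(2)] gz by (simp add: eq_neg_iff_add_eq_0 add.commute)
  have "f2 z * deriv g z = l1 * (deriv f1 z * f2 z) + (l2 * f2 z) * deriv f2 z"
    by (simp add: dg algebra_simps)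
  also have "\<dots> = - (l1 * (f1 z * deriv f2 z - deriv f1 z * f2 z))"
    unfolding e by (simp add: algebra_simps)
  finally have "f2 z * deriv g z = - (l1 * (C * poly P z))" by (simp only: W)
  then have dgz: "deriv g z = - (l1 * C * poly P z) / f2 z" using nz by (simp add: field_simps)
  show "residue_coeff P g z = - 1 / (l1\<^sup>2 * C * deriv (\<lambda>z. f1 z / f2 z) z)"
    unfolding residue_coeff_def D dgz using nz l1 C P by (simp add: field_simps power2_eq_square)
qed

text \<open>All far zeros in the sector are numbered along the progression by \<tau>, up to finitely
  many. The exponent 1 - 1/\<nu> is -N/2.\<close>

lemma stokes_zeros:
  fixes P Q :: "complex poly" and g :: "complex \<Rightarrow> complex" and k :: int
  assumes Q: "Q \<noteq> 0" and g: "g holomorphic_on UNIV" and gnz: "g w0 \<noteq> 0"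
    and suit: "suitable P Q k r \<delta>" and pair: "asymptotic_pair P Q k r \<delta> gp gm"
    and gl: "\<And>z. z \<in> sector P Q k r \<delta> \<Longrightarrow> g z = lp * gp z + lm * gm z" and l: "lp * lm \<noteq> 0"
  defines "\<nu> \<equiv> 2 / (real (gap P Q) + 2)" and "Z \<equiv> sector_zeros P Q g k r \<delta>"
  shows "\<exists>\<tau> :: nat \<Rightarrow> complex. inj \<tau> \<and> range \<tau> \<subseteq> Z \<and> finite (Z - range \<tau>) \<and>
    (\<exists>a b. 0 < a \<and> 0 < b \<and> (\<forall>m. a * real (Suc m) powr \<nu> \<le> cmod (\<tau> m) \<and>
       cmod (\<tau> m) \<le> b * real (Suc m) powr \<nu>)) \<and>
    (\<exists>a b. 0 < a \<and> 0 < b \<and> (\<forall>m. a * cmod (\<tau> m) powr (1 - 1 / \<nu>) \<le> cmod (residue_coeff P g (\<tau> m)) \<and>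
       cmod (residue_coeff P g (\<tau> m)) \<le> b * cmod (\<tau> m) powr (1 - 1 / \<nu>)))"
proof -
  define d where "d = centre P Q"
  define \<theta> where "\<theta> = theta P Q k"
  define \<beta> where "\<beta> = 2 * sqrt (cmod (lead_coeff Q)) / (real (gap P Q) + 2)"
  define S where "S = sector P Q k r \<delta>"
  define s where "s = cos (pi * of_int k)"
  let ?ch = "chart d \<theta> \<beta> \<nu>" and ?\<kappa> = "cochart d \<theta> \<beta> \<nu>"
  have \<beta>: "0 < \<beta>" unfolding \<beta>_def using Q by (intro divide_pos_pos) auto
  have \<nu>: "0 < \<nu>" "\<nu> \<le> 1" unfolding \<nu>_def by auto
  note ch = Ln_chart[OF \<beta> \<nu>, where d = d and \<theta> = \<theta>] cochart_chart[OF \<beta> \<nu>, where d = d and \<theta> = \<theta>]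
    DERIV_chart[OF \<beta> \<nu>, where d = d and \<theta> = \<theta>]
  have r: "0 < r" and \<delta>: "0 < \<delta>" "\<delta> < pi * \<nu>" and Pnz: "\<And>z. z \<in> S \<Longrightarrow> poly P z \<noteq> 0"
    using suit by (auto simp: suitable_def S_def \<nu>_def mult.commute)
  have S: "S = {z. r < cmod (z - d) \<and> \<bar>Arg ((z - d) * cis (- \<theta>))\<bar> < pi * \<nu> - \<delta>}"
    unfolding S_def d_def \<theta>_def \<nu>_def by (rule sector_eq[OF r \<delta>(1)])
  have openS: "open S" unfolding S_def by (rule open_sector[OF r \<delta>(1)])
  have sol: "solves_ode_on P Q S gp" "solves_ode_on P Q S gm"
    using pair by (auto simp: asymptotic_pair_def S_def)
  have hol: "gp holomorphic_on S" "gm holomorphic_on S"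
    using sol by (auto simp: solves_ode_on_def)
  have s: "s = 1 \<or> s = -1" unfolding s_def by simp
  \<comment> \<open>This is the half-opening of the sector after straightening, (pi \<nu> -
    \<delta>) / \<nu>. Taking c <= \<omega> below ensures that \<open>chart\<close> sends the wedge
    into the sector, since |Arg x| < c there.\<close>
  define \<omega> where "\<omega> = pi - \<delta> / \<nu>"
  have \<omega>: "0 < \<omega>" "\<omega> < pi" using \<delta> \<nu> by (auto simp: \<omega>_def field_simps)
  have sin\<omega>: "0 < sin \<omega>" using \<omega> by (intro sin_gt_zero)
  define c where "c = min 1 \<omega>"
  have c: "0 < c" "c \<le> 1" "c \<le> \<omega>" using \<omega> by (auto simp: c_def)
  \<comment> \<open>The first entry is the accuracy required by \<open>wedge_log_deriv\<close>; the
    second is strictly below sin \<omega>, as the exclusion of the left half-plane demands.\<close>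
  define e where "e = min (c\<^sup>2 / 4000) (sin \<omega> / 2)"
  have "c\<^sup>2 \<le> c" using c by (simp add: power2_eq_square mult_left_le)
  moreover have e12: "e \<le> c\<^sup>2 / 4000" "e \<le> sin \<omega> / 2"
    unfolding e_def by (rule min.cobounded1, rule min.cobounded2)
  moreover have "0 < e" using c sin\<omega> by (simp add: e_def)
  ultimately have e: "0 < e" "e \<le> c\<^sup>2 / 4000" "e < sin \<omega>" "e \<le> c / 8"
    using c sin\<omega> by linarith+
  have ln_q: "\<exists>R. \<forall>z\<in>S. R \<le> cmod z \<longrightarrow> gp z \<noteq> 0 \<and> gm z \<noteq> 0 \<and>
      \<bar>ln (cmod (gp z / gm z)) + 2 * s * Im (?\<kappa> z)\<bar> \<le> e * cmod (?\<kappa> z)"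
    unfolding S_def s_def d_def \<theta>_def \<beta>_def \<nu>_def
    by (rule asymptotic_pair_log_quotient[OF Q pair e(1)], intro exI ballI impI) assumption
  then obtain R where R: "\<And>z. z \<in> S \<Longrightarrow> R \<le> cmod z \<Longrightarrow> gp z \<noteq> 0 \<and> gm z \<noteq> 0 \<and>
      \<bar>ln (cmod (gp z / gm z)) + 2 * s * Im (?\<kappa> z)\<bar> \<le> e * cmod (?\<kappa> z)"
    by meson
  \<comment> \<open>The summand 2 |d| makes |z| and |z - d| agree up to a factor 2 from here on, so
    estimates in z - d transfer to z.\<close>
  define R1 where "R1 = \<bar>R\<bar> + r + 2 * cmod d + 2"
  have R1: "R1 \<ge> 2" "R1 > r"
    using r norm_ge_zero[of d] abs_ge_zero[of R] unfolding R1_def by linarith+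
  have far: "R \<le> cmod z" "r < cmod (z - d)" "cmod (z - d) \<le> 2 * cmod z" "cmod z \<le> 2 * cmod (z - d)" "z \<noteq> 0" "z \<noteq> d"
    if z: "R1 \<le> cmod (z - d)" for z
  proof -
    have t: "cmod (z - d) \<le> cmod z + cmod d" "cmod z \<le> cmod (z - d) + cmod d"
      using norm_triangle_ineq4[of z d] norm_triangle_sub[of z d] by auto
    show "R \<le> cmod z" "r < cmod (z - d)" "cmod (z - d) \<le> 2 * cmod z" "cmod z \<le> 2 * cmod (z - d)"
      using z t r norm_ge_zero[of d] unfolding R1_def by linarith+
    then show "z \<noteq> 0" "z \<noteq> d" using r by auto
  qed
  define X where "X = 1 + \<beta> * R1 powr (1 / \<nu>)"
  have X: "1 \<le> X" using \<beta> by (simp add: X_def)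
  have chS: "?ch x \<in> S \<and> R1 \<le> cmod (?ch x - d)" if x: "x \<in> wedge c X" for x
  proof -
    have x0: "x \<noteq> 0" using abs_Arg_le_wedge[OF x] X by simp
    have "X < Re x" using x by (simp add: wedge_def)
    then have "\<beta> * R1 powr (1 / \<nu>) \<le> cmod x"
      using complex_Re_le_cmod[of x] by (simp add: X_def)
    then have "R1 powr (1 / \<nu>) \<le> cmod x / \<beta>" using \<beta> by (simp add: field_simps)
    then have "(R1 powr (1 / \<nu>)) powr \<nu> \<le> (cmod x / \<beta>) powr \<nu>"
      using \<nu> by (intro powr_mono2) auto
    then have 1: "R1 \<le> cmod (?ch x - d)"
      using cmod_chart[OF \<beta> \<nu> x0, of d \<theta>] \<nu> R1 by (simp add: powr_powr)
    have "?ch x - d \<noteq> 0" using far(6)[OF 1] by simp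
    then have "Arg ((?ch x - d) * cis (- \<theta>)) = \<nu> * Arg x"
      using ch(1)[OF x] abs_Arg_le_wedge(3)[OF x] X by (simp add: Arg_eq_Im_Ln)
    moreover have "\<nu> * \<bar>Arg x\<bar> < \<nu> * \<omega>"
      using abs_Arg_le_wedge(1)[OF x] X c \<nu> by (intro mult_strict_left_mono) auto
    moreover have "\<nu> * \<omega> = pi * \<nu> - \<delta>" using \<nu> by (simp add: \<omega>_def field_simps)
    ultimately have "\<bar>Arg ((?ch x - d) * cis (- \<theta>))\<bar> < pi * \<nu> - \<delta>"
      using \<nu> by (simp add: abs_mult)
    then show ?thesis using 1 far(2)[OF 1] by (auto simp: S)
  qed
  have dch: "(?ch has_field_derivative (of_real \<nu> * (?ch x - d) / x)) (at x)" if "x \<in> wedge c X" for x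
    using ch(3)[OF that] X by simp
  have \<kappa>ch: "?\<kappa> (?ch x) = x" if "x \<in> wedge c X" for x
    using ch(2)[OF that] X by simp
  define q where "q = (\<lambda>z. gp z / gm z)"
  define h where "h = (\<lambda>x. q (?ch x))"
  have gnz': "gp (?ch x) \<noteq> 0" "gm (?ch x) \<noteq> 0" if "x \<in> wedge c X" for x
    using R[of "?ch x"] chS[OF that] far(1) by auto
  have dq: "(q has_field_derivative deriv q z) (at z)" if "z \<in> S" "gm z \<noteq> 0" for z
    unfolding q_def using hol openS that
    by (intro DERIV_deriv_iff_field_differentiable[THEN iffD2] field_differentiable_divide)
       (auto simp: holomorphic_on_imp_differentiable_at)
  have dh: "(h has_field_derivative deriv q (?ch x) * (of_real \<nu> * (?ch x - d) / x)) (at x)"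
    if "x \<in> wedge c X" for x
    unfolding h_def using chS[OF that] gnz'(2)[OF that] by (intro DERIV_chain2[OF dq dch[OF that]]) auto
  have holh: "h holomorphic_on wedge c X"
    unfolding holomorphic_on_open[OF open_wedge] using dh by (intro ballI exI)
  have hnz: "h x \<noteq> 0" if "x \<in> wedge c X" for x
    using gnz'[OF that] by (simp add: h_def q_def)
  have hbnd: "\<bar>ln (cmod (h x)) + 2 * s * Im x\<bar> \<le> c\<^sup>2 / 4000 * cmod x" if "x \<in> wedge c X" for x
  proof -
    have "\<bar>ln (cmod (h x)) + 2 * s * Im x\<bar> \<le> e * cmod x"
      using R[of "?ch x"] chS[OF that] far(1) \<kappa>ch[OF that] by (simp add: h_def q_def)
    also have "\<dots> \<le> c\<^sup>2 / 4000 * cmod x" using e by (intro mult_right_mono) auto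
    finally show ?thesis .
  qed
  have lnz: "lp \<noteq> 0" "lm \<noteq> 0" using l by auto
  \<comment> \<open>As both coefficients are nonzero, the zeros of g are the level set of the
    quotient at a finite nonzero value, and that value has a logarithm.\<close>
  define c0 where "c0 = - lm / lp"
  have c0: "c0 \<noteq> 0" using lnz by (simp add: c0_def)
  define K where "K = wedge (c / 2) (2 * X)"
  have Ksub: "K \<subseteq> wedge c X" unfolding K_def using c X by (intro wedge_mono) auto
  obtain \<xi> a0 b0 where dhb: "\<And>x. x \<in> K \<Longrightarrow> cmod (h x) \<le> cmod (deriv h x) \<and> cmod (deriv h x) \<le> 3 * cmod (h x)"
    and inj\<xi>: "inj \<xi>" and ran\<xi>: "range \<xi> \<subseteq> {x \<in> K. h x = c0}"
    and bdd: "bounded ({x \<in> K. h x = c0} - range \<xi>)"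
    and ab0: "0 < a0" "0 < b0"
      "\<And>m. a0 * real (Suc m) \<le> cmod (\<xi> m) \<and> cmod (\<xi> m) \<le> b0 * real (Suc m)"
    using wedge_level_set[OF c(1,2) X s c0 holh hnz hbnd] unfolding K_def by blast
  have \<xi>: "\<xi> m \<in> K" "h (\<xi> m) = c0" "\<xi> m \<in> wedge c X" for m using ran\<xi> Ksub by auto
  have zero_iff: "g z = 0 \<longleftrightarrow> q z = c0" if "z \<in> S" "gm z \<noteq> 0" for z
  proof -
    have "g z = lp * gm z * (q z - c0)"
      using gl that lnz by (simp add: S_def q_def c0_def field_simps)
    then show ?thesis using that lnz by simp
  qed
  define W where "W = (\<lambda>z. (gp z * deriv gm z - deriv gp z * gm z) / poly P z)"
  have dW: "((\<lambda>x. W (?ch x)) has_field_derivative 0) (at x)" if x: "x \<in> wedge c X" for x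
  proof -
    have "(W has_field_derivative 0) (at (?ch x))"
      unfolding W_def using chS[OF x] Pnz by (intro wronskian_derivative[OF openS _ _ sol]) auto
    from DERIV_chain2[OF this dch[OF x]] show ?thesis by simp
  qed
  have "\<exists>C. \<forall>x\<in>wedge c X. W (?ch x) = C"
    by (rule has_field_derivative_zero_constant[OF convex_wedge])
       (rule has_field_derivative_at_within[OF dW])
  then obtain C where C: "\<And>x. x \<in> wedge c X \<Longrightarrow> W (?ch x) = C" by meson
  have WC: "gp (?ch x) * deriv gm (?ch x) - deriv gp (?ch x) * gm (?ch x) = C * poly P (?ch x)"
    if "x \<in> wedge c X" for x
    using C[OF that] Pnz chS[OF that] by (auto simp: W_def field_simps)
  \<comment> \<open>If C vanished, the derivative of h would vanish at a zero found above, against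
    the lower bound |h'| >= |h| > 0.\<close>
  have C0: "C \<noteq> 0"
  proof
    assume "C = 0"
    let ?x = "\<xi> 0"
    have "(q has_field_derivative (deriv gp (?ch ?x) * gm (?ch ?x) - gp (?ch ?x) * deriv gm (?ch ?x))
        / (gm (?ch ?x) * gm (?ch ?x))) (at (?ch ?x))"
      unfolding q_def using chS[OF \<xi>(3)] gnz'[OF \<xi>(3)] hol openS
      by (intro DERIV_divide holomorphic_derivI) auto
    then have "deriv q (?ch ?x) = 0"
      using WC[OF \<xi>(3)] \<open>C = 0\<close> by (simp add: DERIV_imp_deriv)
    then have "deriv h ?x = 0" using DERIV_imp_deriv[OF dh[OF \<xi>(3)]] by simp
    then show False using dhb[OF \<xi>(1), of 0] hnz[OF \<xi>(3), of 0] by simp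
  qed
  define \<tau> where "\<tau> = (\<lambda>m. ?ch (\<xi> m))"
  have inj\<tau>: "inj \<tau>"
    using inj\<xi> \<kappa>ch \<xi>(3) unfolding \<tau>_def inj_def by metis
  have \<tau>S: "\<tau> m \<in> S" "R1 \<le> cmod (\<tau> m - d)" for m using chS[OF \<xi>(3)] by (auto simp: \<tau>_def)
  have g\<tau>: "g (\<tau> m) = 0" for m
    using zero_iff[of "\<tau> m"] \<tau>S gnz'[OF \<xi>(3), of m] \<xi>(2)[of m] by (simp add: \<tau>_def h_def)
  have ran\<tau>: "range \<tau> \<subseteq> Z"
    using \<tau>S g\<tau> far(5) by (auto simp: Z_def sector_zeros_def S_def)
  have fin: "finite (Z - range \<tau>)"
  proof -
    obtain B where B: "\<And>x. x \<in> {x \<in> K. h x = c0} - range \<xi> \<Longrightarrow> cmod x \<le> B"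
      using bdd by (auto simp: bounded_iff)
    \<comment> \<open>Beyond R2 the point x = \<open>cochart\<close> z is so large that it satisfies
      the size condition of \<open>near_axis_in_wedge\<close>, that e |x| dominates |ln |c0||, and
      that |x| exceeds every unlisted solution in K.\<close>
    define R2 where "R2 = R1 + \<bar>4 * X + 1\<bar> / \<beta> + \<bar>ln (cmod c0)\<bar> / e / \<beta> + \<bar>B\<bar> / \<beta>"
    have pos: "0 \<le> \<bar>4 * X + 1\<bar> / \<beta>" "0 \<le> \<bar>ln (cmod c0)\<bar> / e / \<beta>" "0 \<le> \<bar>B\<bar> / \<beta>"
      using \<beta> e by auto
    have "cmod (z - d) \<le> R2" if z: "z \<in> Z - range \<tau>" for z
    proof (rule ccontr)
      assume "\<not> cmod (z - d) \<le> R2"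
      then have big: "R2 < cmod (z - d)" by simp
      then have zR1: "R1 \<le> cmod (z - d)" using pos by (simp add: R2_def)
      note fz = far[OF zR1]
      have zS: "z \<in> S" and gz: "g z = 0" using z by (auto simp: Z_def sector_zeros_def S_def)
      note Rz = R[OF zS fz(1)]
      have "cmod (z - d) powr 1 \<le> cmod (z - d) powr (1 / \<nu>)"
        using zR1 R1 \<nu> by (intro powr_mono) auto
      then have \<kappa>big: "\<beta> * cmod (z - d) \<le> cmod (?\<kappa> z)"
        using cmod_cochart[OF \<beta> \<nu> fz(6), of \<theta>] \<beta> fz(6) by simp
      have "\<bar>4 * X + 1\<bar> / \<beta> < cmod (z - d)" "\<bar>ln (cmod c0)\<bar> / e / \<beta> < cmod (z - d)"
        "\<bar>B\<bar> / \<beta> < cmod (z - d)"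
        using big pos R1 unfolding R2_def by linarith+
      moreover have "u < cmod (?\<kappa> z)" if "u / \<beta> < cmod (z - d)" for u
        using that \<kappa>big \<beta> by (simp add: pos_divide_less_eq mult.commute)
      ultimately have b: "\<bar>4 * X + 1\<bar> < cmod (?\<kappa> z)" "\<bar>ln (cmod c0)\<bar> / e < cmod (?\<kappa> z)"
        "\<bar>B\<bar> < cmod (?\<kappa> z)" by blast+
      have Argz: "\<bar>Arg ((z - d) * cis (- \<theta>))\<bar> < pi * \<nu> - \<delta>" using zS by (simp add: S)
      then have "\<bar>Arg ((z - d) * cis (- \<theta>))\<bar> < pi * \<nu>" using \<delta> by simp
      note co = Arg_cochart[OF \<beta> \<nu> fz(6) this]
      have qz: "q z = c0" using zero_iff[OF zS] Rz gz by simp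
      \<comment> \<open>At a zero log |h| equals ln |c0|, hence 2 |Im x| <= e |x| + |ln |c0|| <= 2 e
        |x|.\<close>
      have "\<bar>ln (cmod c0) + 2 * s * Im (?\<kappa> z)\<bar> \<le> e * cmod (?\<kappa> z)"
        using Rz qz by (simp add: q_def)
      moreover have "\<bar>2 * s * Im (?\<kappa> z)\<bar> = 2 * \<bar>Im (?\<kappa> z)\<bar>" using s by auto
      moreover have "\<bar>ln (cmod c0)\<bar> \<le> e * cmod (?\<kappa> z)" using b(2) e by (simp add: field_simps)
      ultimately have im: "\<bar>Im (?\<kappa> z)\<bar> \<le> e * cmod (?\<kappa> z)" by linarith
      have "\<bar>Arg (?\<kappa> z)\<bar> < \<omega>"
        unfolding co(2) using Argz \<nu> by (simp add: \<omega>_def field_simps abs_divide)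
      then have \<kappa>K: "?\<kappa> z \<in> K"
        unfolding K_def using near_axis_in_wedge[OF _ \<omega>(2) c(1,2) e(3,4) im, of "2 * X"] b(1) X by simp
      have h\<kappa>: "h (?\<kappa> z) = c0" using qz co(3) by (simp add: h_def)
      have "?\<kappa> z \<notin> range \<xi>"
      proof
        assume "?\<kappa> z \<in> range \<xi>"
        then obtain m where "?\<kappa> z = \<xi> m" by blast
        then have "z = \<tau> m" using co(3) by (simp add: \<tau>_def)
        then show False using z by blast
      qed
      then have "cmod (?\<kappa> z) \<le> B" using B \<kappa>K h\<kappa> by blast
      then show False using b(3) by simp
    qed
    then have sub: "Z - range \<tau> \<subseteq> {z \<in> cball d R2. g z = 0}"
      by (auto simp: Z_def sector_zeros_def dist_norm norm_minus_commute)
    have "\<not> g constant_on UNIV"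
      using gnz g\<tau>[of 0] unfolding constant_on_def by (metis UNIV_I)
    then have "finite {z \<in> cball d R2. g z = 0}"
      using g by (intro holomorphic_compact_finite_zeros[of g UNIV]) auto
    then show ?thesis using sub by (rule rev_finite_subset)
  qed
  have \<tau>bd: "(a0 / \<beta>) powr \<nu> / 2 * real (Suc m) powr \<nu> \<le> cmod (\<tau> m) \<and>
       cmod (\<tau> m) \<le> 2 * (b0 / \<beta>) powr \<nu> * real (Suc m) powr \<nu>" for m
  proof -
    have "\<xi> m \<noteq> 0" using ab0(1) ab0(3)[of m] by (auto simp: mult_le_0_iff)
    then have eq: "cmod (\<tau> m - d) = (cmod (\<xi> m) / \<beta>) powr \<nu>"
      using cmod_chart[OF \<beta> \<nu>] by (simp add: \<tau>_def)
    have "(a0 / \<beta> * real (Suc m)) powr \<nu> \<le> (cmod (\<xi> m) / \<beta>) powr \<nu>"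
      using divide_right_mono[of "a0 * real (Suc m)" "cmod (\<xi> m)" \<beta>] ab0(3)[of m] ab0(1) \<beta> \<nu>
      by (intro powr_mono2) auto
    moreover have "(cmod (\<xi> m) / \<beta>) powr \<nu> \<le> (b0 / \<beta> * real (Suc m)) powr \<nu>"
      using divide_right_mono[of "cmod (\<xi> m)" "b0 * real (Suc m)" \<beta>] ab0(3)[of m] ab0(2) \<beta> \<nu>
      by (intro powr_mono2) auto
    ultimately have "(a0 / \<beta>) powr \<nu> * real (Suc m) powr \<nu> \<le> cmod (\<tau> m - d)"
      "cmod (\<tau> m - d) \<le> (b0 / \<beta>) powr \<nu> * real (Suc m) powr \<nu>"
      unfolding eq using ab0 \<beta> by (simp_all only: powr_mult)
    then show ?thesis using far(3,4)[OF \<tau>S(2)[of m]] by argo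
  qed
  define p where "p = 1 - 1 / \<nu>"
  have p: "p \<le> 0" using \<nu> by (simp add: p_def field_simps)
  \<comment> \<open>By the chain rule |q'| = |h'| |x| / (\<nu> |z - d|) with |x| = \<beta> |z -
    d|^(1/\<nu>); M collects the constants of 1 / (|lp|^2 |C| |q'|).\<close>
  define M where "M = \<nu> / (\<beta> * (cmod lp)\<^sup>2 * cmod C)"
  have M: "0 < M" using \<nu> \<beta> lnz C0 by (simp add: M_def)
  have res: "cmod (residue_coeff P g (\<tau> m)) = M * cmod (\<tau> m - d) powr p / cmod (deriv h (\<xi> m))" for m
  proof -
    let ?z = "\<tau> m" and ?x = "\<xi> m"
    have zd: "?z \<noteq> d" using far(6) \<tau>S by blast
    have gm: "gm ?z \<noteq> 0" using gnz'[OF \<xi>(3)] by (simp add: \<tau>_def)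
    have gl': "\<And>z. z \<in> S \<Longrightarrow> g z = lp * gp z + lm * gm z" using gl by (simp add: S_def)
    have W': "gp ?z * deriv gm ?z - deriv gp ?z * gm ?z = C * poly P ?z"
      using WC[OF \<xi>(3)] by (simp add: \<tau>_def)
    note rc = residue_coeff_eq[where z = "\<tau> m" and g = g, OF openS \<tau>S(1) hol gl' g\<tau> lnz(1) gm
        Pnz[OF \<tau>S(1)] C0 W', folded q_def]
    have x: "?x \<noteq> 0" "cmod ?x = \<beta> * cmod (?z - d) powr (1 / \<nu>)"
      using cmod_cochart[OF \<beta> \<nu> zd, of \<theta>] \<kappa>ch[OF \<xi>(3), of m] abs_Arg_le_wedge(4)[OF \<xi>(3)] X
      by (auto simp: \<tau>_def)
    have "cmod (deriv h ?x) = cmod (deriv q ?z) * (\<nu> * cmod (?z - d) / cmod ?x)"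
      using DERIV_imp_deriv[OF dh[OF \<xi>(3)], of m] \<nu> by (simp add: \<tau>_def norm_mult norm_divide)
    then have "cmod (deriv q ?z) = cmod (deriv h ?x) * cmod ?x / (\<nu> * cmod (?z - d))"
      using x zd \<nu> \<beta> by (simp add: field_simps)
    moreover have "residue_coeff P g ?z = - 1 / (lp\<^sup>2 * C * deriv q ?z)"
      using rc(2) .
    ultimately have "cmod (residue_coeff P g ?z) = \<nu> * cmod (?z - d) / ((cmod lp)\<^sup>2 * cmod C * cmod (deriv h ?x) * cmod ?x)"
      by (simp add: norm_divide norm_mult norm_power mult_ac)
    also have "\<dots> = M * (cmod (?z - d) / cmod (?z - d) powr (1 / \<nu>)) / cmod (deriv h ?x)"
      unfolding x(2) M_def by (simp add: mult_ac)
    also have "cmod (?z - d) / cmod (?z - d) powr (1 / \<nu>) = cmod (?z - d) powr p"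
      using zd by (simp add: p_def powr_diff)
    finally show ?thesis .
  qed
  have resbd: "M * 2 powr p / (3 * cmod c0) * cmod (\<tau> m) powr p \<le> cmod (residue_coeff P g (\<tau> m)) \<and>
      cmod (residue_coeff P g (\<tau> m)) \<le> M * 2 powr (- p) / cmod c0 * cmod (\<tau> m) powr p" for m
  proof -
    let ?z = "\<tau> m"
    note fz = far[OF \<tau>S(2)[of m]]
    have D: "cmod c0 \<le> cmod (deriv h (\<xi> m))" "cmod (deriv h (\<xi> m)) \<le> 3 * cmod c0"
      using dhb[OF \<xi>(1)[of m]] \<xi>(2)[of m] by auto
    have c0p: "0 < cmod c0" using c0 by simp
    have "(2 * cmod ?z) powr p \<le> cmod (?z - d) powr p"
      using fz p by (intro powr_mono2') auto
    then have lo: "2 powr p * cmod ?z powr p \<le> cmod (?z - d) powr p" by (simp add: powr_mult)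
    have "cmod (?z - d) powr p \<le> (cmod ?z / 2) powr p"
      using fz p by (intro powr_mono2') auto
    also have "\<dots> = 2 powr (- p) * cmod ?z powr p"
      by (simp add: powr_divide powr_minus_divide)
    finally have hi: "cmod (?z - d) powr p \<le> 2 powr (- p) * cmod ?z powr p" .
    have "M * (2 powr p * cmod ?z powr p) / (3 * cmod c0) \<le> M * cmod (?z - d) powr p / cmod (deriv h (\<xi> m))"
      using lo M D c0p by (intro frac_le mult_left_mono mult_nonneg_nonneg) auto
    moreover have "M * cmod (?z - d) powr p / cmod (deriv h (\<xi> m)) \<le> M * (2 powr (- p) * cmod ?z powr p) / cmod c0"
      using hi M D c0p by (intro frac_le mult_left_mono mult_nonneg_nonneg) auto
    ultimately show ?thesis unfolding res by (simp add: mult_ac)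
  qed
  have pos: "0 < (a0 / \<beta>) powr \<nu> / 2" "0 < 2 * (b0 / \<beta>) powr \<nu>"
    "0 < M * 2 powr p / (3 * cmod c0)" "0 < M * 2 powr (- p) / cmod c0"
    using ab0 \<beta> M c0 by auto
  have "\<exists>a b. 0 < a \<and> 0 < b \<and> (\<forall>m. a * real (Suc m) powr \<nu> \<le> cmod (\<tau> m) \<and>
       cmod (\<tau> m) \<le> b * real (Suc m) powr \<nu>)"
    by (rule exI[of _ "(a0 / \<beta>) powr \<nu> / 2"], rule exI[of _ "2 * (b0 / \<beta>) powr \<nu>"])
       (intro conjI allI pos \<tau>bd[THEN conjunct1] \<tau>bd[THEN conjunct2])
  moreover have "\<exists>a b. 0 < a \<and> 0 < b \<and> (\<forall>m. a * cmod (\<tau> m) powr (1 - 1 / \<nu>) \<le>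
       cmod (residue_coeff P g (\<tau> m)) \<and> cmod (residue_coeff P g (\<tau> m)) \<le> b * cmod (\<tau> m) powr (1 - 1 / \<nu>))"
    unfolding p_def[symmetric]
    by (rule exI[of _ "M * 2 powr p / (3 * cmod c0)"], rule exI[of _ "M * 2 powr (- p) / cmod c0"])
       (intro conjI allI pos resbd[THEN conjunct1] resbd[THEN conjunct2])
  ultimately show ?thesis
    using inj\<tau> ran\<tau> fin by (intro exI[of _ \<tau>] conjI)
qed

section \<open>Growth of the zeros and summability\<close>

text \<open>The exponent used later, -1/\<nu> - \<alpha>, changes sign with \<alpha>. Minimum and
  maximum cover the increasing and the decreasing case together.\<close>

lemma powr_between:
  fixes T :: real
  assumes "0 < a" "0 < v" "a * v \<le> T" "T \<le> b * v"
  shows "min (a powr q) (b powr q) * v powr q \<le> T powr q \<and> T powr q \<le> max (a powr q) (b powr q) * v powr q"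
proof -
  have T: "0 < a * v" "0 < T" using assms by (auto intro: less_le_trans[of 0 "a * v"])
  then have b: "0 < b" using assms by (smt (verit) zero_less_mult_pos2)
  have "min (a powr q) (b powr q) * v powr q = min ((a * v) powr q) ((b * v) powr q)"
    "max (a powr q) (b powr q) * v powr q = max ((a * v) powr q) ((b * v) powr q)"
    by (simp_all add: powr_mult min_mult_distrib_right max_mult_distrib_right)
  moreover have "((a * v) powr q \<le> T powr q \<and> T powr q \<le> (b * v) powr q) \<or>
      ((b * v) powr q \<le> T powr q \<and> T powr q \<le> (a * v) powr q)"
  proof (cases "0 \<le> q")
    case True
    then show ?thesis using T assms by (intro disjI1 conjI powr_mono2) auto
  next
    case False
    then show ?thesis using T assms by (intro disjI2 conjI powr_mono2') auto
  qed
  ultimately show ?thesis by auto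
qed

text \<open>The exponents combine to \<nu> (1 - 1/\<nu> - (1 + \<alpha>)) = -1 - \<nu> \<alpha>. The
  index u is left general because it is n for the ordering by modulus and n + 1 for the numbering
  \<tau>.\<close>

lemma quotient_bigtheta:
  fixes T R u :: "nat \<Rightarrow> real"
  assumes \<nu>: "0 < \<nu>" and ab: "0 < a" "0 < b" "0 < a'" "0 < b'"
    and u: "\<forall>\<^sub>F n in at_top. 0 < u n"
    and T: "\<forall>\<^sub>F n in at_top. a * u n powr \<nu> \<le> T n \<and> T n \<le> b * u n powr \<nu>"
    and R: "\<forall>\<^sub>F n in at_top. a' * T n powr (1 - 1 / \<nu>) \<le> R n \<and> R n \<le> b' * T n powr (1 - 1 / \<nu>)"
  shows "(\<lambda>n. R n / T n powr (1 + \<alpha>)) \<in> \<Theta>(\<lambda>n. u n powr (- 1 - \<nu> * \<alpha>))"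
proof -
  define q where "q = 1 - 1 / \<nu> - (1 + \<alpha>)"
  let ?m = "min (a powr q) (b powr q)" and ?M = "max (a powr q) (b powr q)"
  have q: "\<nu> * q = - 1 - \<nu> * \<alpha>" using \<nu> by (simp add: q_def field_simps)
  show ?thesis
  proof (rule bigthetaI'[of "a' * ?m" "b' * ?M"])
    show "0 < a' * ?m" "0 < b' * ?M" using ab by (auto simp: less_max_iff_disj)
    show "\<forall>\<^sub>F n in at_top. a' * ?m * norm (u n powr (- 1 - \<nu> * \<alpha>)) \<le> norm (R n / T n powr (1 + \<alpha>)) \<and>
        norm (R n / T n powr (1 + \<alpha>)) \<le> b' * ?M * norm (u n powr (- 1 - \<nu> * \<alpha>))"
      using u T R
    proof eventually_elim
      case (elim n)
      have v: "0 < u n powr \<nu>" using elim by simp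
      have Tpos: "0 < T n" using elim ab mult_pos_pos[OF ab(1) v] by linarith
      have vq: "(u n powr \<nu>) powr q = u n powr (- 1 - \<nu> * \<alpha>)" by (simp add: powr_powr q)
      have pb: "?m * u n powr (- 1 - \<nu> * \<alpha>) \<le> T n powr q" "T n powr q \<le> ?M * u n powr (- 1 - \<nu> * \<alpha>)"
        using powr_between[OF ab(1) v, of "T n" b q] elim unfolding vq by auto
      have e: "T n powr q = T n powr (1 - 1 / \<nu>) / T n powr (1 + \<alpha>)"
        unfolding q_def by (rule powr_diff)
      have "a' * T n powr (1 - 1 / \<nu>) / T n powr (1 + \<alpha>) \<le> R n / T n powr (1 + \<alpha>)"
        "R n / T n powr (1 + \<alpha>) \<le> b' * T n powr (1 - 1 / \<nu>) / T n powr (1 + \<alpha>)"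
        using elim by (intro divide_right_mono; simp)+
      then have *: "a' * T n powr q \<le> R n / T n powr (1 + \<alpha>)" "R n / T n powr (1 + \<alpha>) \<le> b' * T n powr q"
        by (simp_all add: e)
      have "0 \<le> a' * T n powr q" using ab by simp
      then have "0 \<le> R n / T n powr (1 + \<alpha>)" using *(1) by linarith
      then have nR: "norm (R n / T n powr (1 + \<alpha>)) = R n / T n powr (1 + \<alpha>)"
        by (simp only: real_norm_def abs_of_nonneg)
      have nu: "norm (u n powr (- 1 - \<nu> * \<alpha>)) = u n powr (- 1 - \<nu> * \<alpha>)" by simp
      have "a' * (?m * u n powr (- 1 - \<nu> * \<alpha>)) \<le> a' * T n powr q"
        "b' * T n powr q \<le> b' * (?M * u n powr (- 1 - \<nu> * \<alpha>))"
        using pb ab by (intro mult_left_mono; simp)+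
      then show ?case using * unfolding nR nu mult.assoc by linarith
    qed
  qed
qed

lemma summable_iff_of_bigtheta:
  fixes f g :: "nat \<Rightarrow> real"
  assumes fg: "f \<in> \<Theta>(g)" and nonneg: "\<And>n. 0 \<le> f n" "\<And>n. 0 \<le> g n"
  shows "summable f \<longleftrightarrow> summable g"
proof
  have gf: "g \<in> \<Theta>(f)" using fg by (simp add: bigtheta_sym)
  assume "summable f"
  then show "summable g"
    using gf nonneg by (intro summable_comparison_test_bigo[of f g]) auto
next
  assume "summable g"
  then show "summable f"
    using fg nonneg by (intro summable_comparison_test_bigo[of g f]) auto
qed

lemma exists_index_ge:
  fixes J :: "nat set"
  assumes "finite J" "card J > n"
  shows "\<exists>j\<in>J. n \<le> j"
proof (rule ccontr)
  assume "\<not> ?thesis"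
  then have "J \<subseteq> {..<n}" by auto
  then show False using card_mono[of "{..<n}" J] assms by simp
qed

text \<open>Upper bound: the first n values of \<tau> are n elements of Z of modulus at most b
  n^\<nu>, so the n-th smallest modulus is no larger. Lower bound: at most c of t 1, ..., t n lie
  off the range of \<tau>, so one of them is \<tau> i with i + 1 >= n - c, which is at least n/2 for
  n > 2c.\<close>

lemma rearranged_growth:
  fixes Z :: "complex set" and t \<tau> :: "nat \<Rightarrow> complex"
  assumes t: "bij_betw t {1..} Z" and mono: "mono_on {1..} (\<lambda>n. cmod (t n))"
    and \<tau>: "inj \<tau>" "range \<tau> \<subseteq> Z" "finite (Z - range \<tau>)"
    and \<nu>: "0 < \<nu>" and a: "0 < a" "0 < b"
    and bd: "\<And>m. a * real (Suc m) powr \<nu> \<le> cmod (\<tau> m) \<and> cmod (\<tau> m) \<le> b * real (Suc m) powr \<nu>"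
  shows "\<forall>\<^sub>F n in at_top. a / 2 powr \<nu> * real n powr \<nu> \<le> cmod (t n) \<and> cmod (t n) \<le> b * real n powr \<nu>"
proof -
  have injt: "inj_on t {1..}" and imt: "t ` {1..} = Z" using t by (auto simp: bij_betw_def)
  define c where "c = card (Z - range \<tau>)"
  have upper: "cmod (t n) \<le> b * real n powr \<nu>" if n: "1 \<le> n" for n
  proof -
    define J where "J = {j \<in> {1..}. t j \<in> \<tau> ` {..<n}}"
    have tJ: "t ` J = \<tau> ` {..<n}"
    proof
      show "t ` J \<subseteq> \<tau> ` {..<n}" by (auto simp: J_def)
      show "\<tau> ` {..<n} \<subseteq> t ` J"
      proof
        fix z assume z: "z \<in> \<tau> ` {..<n}"
        then have "z \<in> t ` {1..}" using \<tau>(2) imt by auto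
        then obtain j where "j \<in> {1..}" "z = t j" by blast
        then show "z \<in> t ` J" using z by (simp add: J_def)
      qed
    qed
    have iJ: "inj_on t J" using injt by (rule inj_on_subset) (auto simp: J_def)
    have "finite (t ` J)" by (simp add: tJ)
    then have "finite J" using iJ by (rule finite_imageD)
    moreover have "card J = card (\<tau> ` {..<n})" unfolding tJ[symmetric] by (simp add: card_image iJ)
    then have "card J = n" using \<tau>(1) by (simp add: card_image inj_on_subset)
    ultimately have J: "finite J" "card J = n" by auto
    \<comment> \<open>Indices start at 1, so J has n positive members. Adjoining 0 gives n + 1
      natural numbers, one of which is at least n; without it the pigeonhole would yield only n -
      1.\<close>
    have "0 \<notin> J" by (simp add: J_def)
    then have "card (insert 0 J) > n" using J by simp
    then obtain j where j: "j \<in> insert 0 J" "n \<le> j" using exists_index_ge[of "insert 0 J" n] J by blast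
    then have jJ: "j \<in> J" using n by auto
    then obtain i where i: "i < n" "t j = \<tau> i" by (auto simp: J_def)
    have "cmod (t n) \<le> cmod (t j)"
      using mono n j by (auto simp: mono_on_def)
    also have "\<dots> \<le> b * real (Suc i) powr \<nu>" using bd i by simp
    also have "\<dots> \<le> b * real n powr \<nu>"
      using i a \<nu> by (intro mult_left_mono powr_mono2) auto
    finally show ?thesis .
  qed
  have lower: "a / 2 powr \<nu> * real n powr \<nu> \<le> cmod (t n)" if n: "2 * c + 1 \<le> n" for n
  proof -
    define I where "I = {i. \<tau> i \<in> t ` {1..n}}"
    have fin: "finite (t ` {1..n})" by simp
    have sub: "t ` {1..n} \<subseteq> Z" using imt by auto
    have \<tau>I: "\<tau> ` I = t ` {1..n} - (Z - range \<tau>)"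
    proof (intro equalityI subsetI)
      fix z assume z: "z \<in> t ` {1..n} - (Z - range \<tau>)"
      then obtain i where "z = \<tau> i" using sub by blast
      then show "z \<in> \<tau> ` I" using z by (simp add: I_def)
    qed (auto simp: I_def)
    have injI: "inj_on \<tau> I" using \<tau>(1) by (rule inj_on_subset) simp
    have finI: "finite I" using \<tau>I fin injI by (metis finite_Diff finite_imageD)
    have "card (t ` {1..n}) = n"
      using card_image[OF inj_on_subset[OF injt, of "{1..n}"]] by auto
    then have "n - c \<le> card I"
      using diff_card_le_card_Diff[OF \<tau>(3), of "t ` {1..n}"] \<tau>I card_image[OF injI] by (simp add: c_def)
    then have "n - c - 1 < card I" using n by linarith
    then obtain i where i: "i \<in> I" "n - c - 1 \<le> i" using exists_index_ge[OF finI] by blast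
    then obtain j where j: "1 \<le> j" "j \<le> n" "\<tau> i = t j" by (auto simp: I_def)
    have "n \<le> Suc i + Suc i" using i n by linarith
    then have "real n / 2 \<le> real (Suc i)" by linarith
    then have "(real n / 2) powr \<nu> \<le> real (Suc i) powr \<nu>" using \<nu> by (intro powr_mono2) auto
    then have "a * (real n / 2) powr \<nu> \<le> a * real (Suc i) powr \<nu>" using a by (intro mult_left_mono) auto
    also have "\<dots> \<le> cmod (t j)" using bd[of i] j by simp
    also have "\<dots> \<le> cmod (t n)" using mono j by (auto simp: mono_on_def)
    finally show ?thesis by (simp add: powr_divide)
  qed
  show ?thesis
    using eventually_ge_at_top[of "2 * c + 1"] by eventually_elim (use upper lower in auto)
qed

theorem corollary2p19:
  fixes P Q :: "complex poly" and g :: "complex \<Rightarrow> complex" and r \<delta> :: "int \<Rightarrow> real"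
  assumes "ode_setting P Q"
    and "solves_ode_on P Q UNIV g" and "\<exists>z. g z \<noteq> 0"
    and "\<And>k. 0 \<le> k \<Longrightarrow> k \<le> int (gap P Q) + 1 \<Longrightarrow> suitable P Q k (r k) (\<delta> k)"
  shows "(\<forall>k t. stokes_sequence P Q g k (r k) (\<delta> k) t \<longrightarrow>
            (\<forall>\<alpha>::real.
              (\<lambda>n. cmod (residue_coeff P g (t n)) / cmod (t n) powr (1 + \<alpha>))
                \<in> \<Theta>(\<lambda>n. real n powr (- 1 - 2 * \<alpha> / (real (gap P Q) + 2))) \<and>
              (summable (\<lambda>n. cmod (residue_coeff P g (t (Suc n)))
                               / cmod (t (Suc n)) powr (1 + \<alpha>))
                 \<longleftrightarrow> \<alpha> > 0))) \<and>
         ((\<exists>k. stokes_index P Q g k (r k) (\<delta> k)) \<longrightarrow>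
            (\<forall>\<alpha>::real.
              (\<lambda>z. cmod (residue_coeff P g z) / cmod z powr (1 + \<alpha>)) summable_on
                (\<Union>k\<in>{k. stokes_index P Q g k (r k) (\<delta> k)}. sector_zeros P Q g k (r k) (\<delta> k))
              \<longleftrightarrow> \<alpha> > 0))"
proof -
  define \<nu> where "\<nu> = 2 / (real (gap P Q) + 2)"
  have \<nu>: "0 < \<nu>" by (simp add: \<nu>_def)
  define Z where "Z = (\<lambda>k. sector_zeros P Q g k (r k) (\<delta> k))"
  define f where "f = (\<lambda>\<alpha> z. cmod (residue_coeff P g z) / cmod z powr (1 + \<alpha>))"
  have f0: "0 \<le> f \<alpha> z" for \<alpha> z by (simp add: f_def)
  have Q: "Q \<noteq> 0" using assms(1) by (simp add: ode_setting_def)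
  have hol: "g holomorphic_on UNIV" using assms(2) by (simp add: solves_ode_on_def)
  obtain w0 where w0: "g w0 \<noteq> 0" using assms(3) by blast
  have main: "\<exists>\<tau> :: nat \<Rightarrow> complex. inj \<tau> \<and> range \<tau> \<subseteq> Z k \<and> finite (Z k - range \<tau>) \<and>
    (\<exists>a b. 0 < a \<and> 0 < b \<and> (\<forall>m. a * real (Suc m) powr \<nu> \<le> cmod (\<tau> m) \<and>
       cmod (\<tau> m) \<le> b * real (Suc m) powr \<nu>)) \<and>
    (\<exists>a b. 0 < a \<and> 0 < b \<and> (\<forall>m. a * cmod (\<tau> m) powr (1 - 1 / \<nu>) \<le> cmod (residue_coeff P g (\<tau> m)) \<and>
       cmod (residue_coeff P g (\<tau> m)) \<le> b * cmod (\<tau> m) powr (1 - 1 / \<nu>)))"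
    if k: "stokes_index P Q g k (r k) (\<delta> k)" for k
  proof -
    obtain gp gm lp lm where "asymptotic_pair P Q k (r k) (\<delta> k) gp gm"
      "\<And>z. z \<in> sector P Q k (r k) (\<delta> k) \<Longrightarrow> g z = lp * gp z + lm * gm z" "lp * lm \<noteq> 0"
      using k unfolding stokes_index_def by blast
    moreover have "suitable P Q k (r k) (\<delta> k)" using k assms(4) by (simp add: stokes_index_def)
    ultimately show ?thesis
      unfolding \<nu>_def Z_def by (intro stokes_zeros[OF Q hol w0]) auto
  qed
  have powr_summable: "summable (\<lambda>n. real (Suc n) powr (- 1 - \<nu> * \<alpha>)) \<longleftrightarrow> 0 < \<alpha>" for \<alpha>
  proof -
    have "summable (\<lambda>n. real (Suc n) powr (- 1 - \<nu> * \<alpha>)) \<longleftrightarrow> summable (\<lambda>n. real n powr (- 1 - \<nu> * \<alpha>))"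
      by (rule summable_Suc_iff)
    also have "\<dots> \<longleftrightarrow> - 1 - \<nu> * \<alpha> < - 1" by (rule summable_real_powr_iff)
    finally show ?thesis using \<nu> by (simp add: zero_less_mult_iff)
  qed
  have seq: "(\<lambda>n. f \<alpha> (t n)) \<in> \<Theta>(\<lambda>n. real n powr (- 1 - \<nu> * \<alpha>))"
    if st: "stokes_sequence P Q g k (r k) (\<delta> k) t" for k t \<alpha>
  proof -
    have t: "bij_betw t {1..} (Z k)" and mono: "mono_on {1..} (\<lambda>n. cmod (t n))"
      and k: "stokes_index P Q g k (r k) (\<delta> k)"
      using st by (auto simp: stokes_sequence_def Z_def)
    obtain \<tau> :: "nat \<Rightarrow> complex" and a b a' b' where \<tau>: "inj \<tau>" "range \<tau> \<subseteq> Z k" "finite (Z k - range \<tau>)"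
      and ab: "0 < a" "0 < b" "0 < a'" "0 < b'"
      and bd: "\<And>m. a * real (Suc m) powr \<nu> \<le> cmod (\<tau> m) \<and> cmod (\<tau> m) \<le> b * real (Suc m) powr \<nu>"
      and res: "\<And>m. a' * cmod (\<tau> m) powr (1 - 1 / \<nu>) \<le> cmod (residue_coeff P g (\<tau> m)) \<and>
        cmod (residue_coeff P g (\<tau> m)) \<le> b' * cmod (\<tau> m) powr (1 - 1 / \<nu>)"
      using main[OF k] by metis
    have injt: "inj_on t {1..}" using t by (rule bij_betw_imp_inj_on)
    \<comment> \<open>The residue estimate is known on the range of \<tau>. Since t is injective,
      the finitely many other zeros occupy finitely many indices.\<close>
    have "finite (t -` (Z k - range \<tau>) \<inter> {1..})"
      using finite_vimage_IntI[OF \<tau>(3) injt] .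
    then have "finite {n \<in> {1..}. t n \<in> Z k - range \<tau>}"
      by (rule rev_finite_subset) auto
    then have "\<forall>\<^sub>F n in at_top. n \<notin> {n \<in> {1..}. t n \<in> Z k - range \<tau>}"
      unfolding cofinite_eq_sequentially[symmetric] eventually_cofinite by (simp only: not_not Collect_mem_eq)
    then have "\<forall>\<^sub>F n in at_top. t n \<in> range \<tau>"
      using eventually_ge_at_top[of "1::nat"]
      by eventually_elim (use bij_betwE[OF t] in auto)
    then have R: "\<forall>\<^sub>F n in at_top. a' * cmod (t n) powr (1 - 1 / \<nu>) \<le> cmod (residue_coeff P g (t n)) \<and>
        cmod (residue_coeff P g (t n)) \<le> b' * cmod (t n) powr (1 - 1 / \<nu>)"
      by eventually_elim (use res in auto)
    have "0 < a / 2 powr \<nu>" using ab by simp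
    from quotient_bigtheta[OF \<nu> this ab(2-4) _ rearranged_growth[OF t mono \<tau> \<nu> ab(1,2) bd] R]
    show ?thesis
      unfolding f_def using eventually_gt_at_top[of "0::nat"] by (auto elim: eventually_mono)
  qed
  \<comment> \<open>Summability over a set ignores order, so the numbering \<tau> serves directly
    and no enumeration by modulus enters.\<close>
  have sum_Z: "f \<alpha> summable_on Z k \<longleftrightarrow> 0 < \<alpha>"
    if k: "stokes_index P Q g k (r k) (\<delta> k)" for k \<alpha>
  proof -
    obtain \<tau> :: "nat \<Rightarrow> complex" and a b a' b' where \<tau>: "inj \<tau>" "range \<tau> \<subseteq> Z k" "finite (Z k - range \<tau>)"
      and ab: "0 < a" "0 < b" "0 < a'" "0 < b'"
      and bd: "\<And>m. a * real (Suc m) powr \<nu> \<le> cmod (\<tau> m) \<and> cmod (\<tau> m) \<le> b * real (Suc m) powr \<nu>"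
      and res: "\<And>m. a' * cmod (\<tau> m) powr (1 - 1 / \<nu>) \<le> cmod (residue_coeff P g (\<tau> m)) \<and>
        cmod (residue_coeff P g (\<tau> m)) \<le> b' * cmod (\<tau> m) powr (1 - 1 / \<nu>)"
      using main[OF k] by metis
    have "(\<lambda>m. cmod (residue_coeff P g (\<tau> m)) / cmod (\<tau> m) powr (1 + \<alpha>))
        \<in> \<Theta>(\<lambda>m. real (Suc m) powr (- 1 - \<nu> * \<alpha>))"
      by (rule quotient_bigtheta[OF \<nu> ab]) (use bd res in \<open>auto intro!: always_eventually\<close>)
    then have "summable (\<lambda>m. f \<alpha> (\<tau> m)) \<longleftrightarrow> 0 < \<alpha>"
      using summable_iff_of_bigtheta[of "\<lambda>m. f \<alpha> (\<tau> m)" "\<lambda>m. real (Suc m) powr (- 1 - \<nu> * \<alpha>)"]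
        powr_summable[of \<alpha>] f0 by (simp add: f_def)
    moreover have "f \<alpha> summable_on range \<tau> \<longleftrightarrow> summable (\<lambda>m. f \<alpha> (\<tau> m))"
      using summable_on_reindex[OF \<tau>(1), of "f \<alpha>"]
        summable_on_UNIV_nonneg_real_iff[of "\<lambda>m. f \<alpha> (\<tau> m)"] f0 by (simp add: o_def)
    moreover have "f \<alpha> summable_on Z k \<longleftrightarrow> f \<alpha> summable_on range \<tau>"
    proof
      show "f \<alpha> summable_on range \<tau>" if "f \<alpha> summable_on Z k"
        using summable_on_subset_banach[OF that \<tau>(2)] .
      have eq: "range \<tau> \<union> (Z k - range \<tau>) = Z k" using \<tau>(2) by blast
      show "f \<alpha> summable_on Z k" if "f \<alpha> summable_on range \<tau>"
        using summable_on_union[OF that summable_on_finite[OF \<tau>(3)]] unfolding eq .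
    qed
    ultimately show ?thesis by blast
  qed
  define K where "K = {k. stokes_index P Q g k (r k) (\<delta> k)}"
  have finK: "finite K"
    by (rule finite_subset[of _ "{0..int (gap P Q) + 1}"]) (auto simp: K_def stokes_index_def)
  \<comment> \<open>Neighbouring sectors may overlap, and a zero in both is counted once. Subset
    monotonicity gives one direction and finite unions the other; over an empty union the sum would
    converge for every \<alpha>, hence the assumption on K.\<close>
  have union: "f \<alpha> summable_on (\<Union>k\<in>K. Z k) \<longleftrightarrow> 0 < \<alpha>" if ne: "K \<noteq> {}" for \<alpha>
  proof
    assume s: "f \<alpha> summable_on (\<Union>k\<in>K. Z k)"
    obtain k where "k \<in> K" using ne by blast
    then show "0 < \<alpha>"
      using summable_on_subset_banach[OF s, of "Z k"] sum_Z[of k \<alpha>] by (auto simp: K_def)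
  next
    assume \<alpha>: "0 < \<alpha>"
    have "f \<alpha> summable_on (\<Union>k\<in>L. Z k)" if "finite L" "L \<subseteq> K" for L
      using that
    proof (induction L)
      case (insert k L)
      then show ?case
        using summable_on_union[of "f \<alpha>" "Z k" "\<Union>k\<in>L. Z k"] sum_Z[of k \<alpha>] \<alpha> by (auto simp: K_def)
    qed simp
    then show "f \<alpha> summable_on (\<Union>k\<in>K. Z k)" using finK by blast
  qed
  have ex: "- 1 - 2 * \<alpha> / (real (gap P Q) + 2) = - 1 - \<nu> * \<alpha>" for \<alpha> :: real
    by (simp add: \<nu>_def)
  have sum_t: "summable (\<lambda>n. f \<alpha> (t (Suc n))) \<longleftrightarrow> 0 < \<alpha>"
    if st: "stokes_sequence P Q g k (r k) (\<delta> k) t" for k t \<alpha>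
  proof -
    \<comment> \<open>The value t 0 is arbitrary, but one term affects neither the Theta relation
      nor convergence.\<close>
    have "summable (\<lambda>n. f \<alpha> (t (Suc n))) \<longleftrightarrow> summable (\<lambda>n. f \<alpha> (t n))"
      by (rule summable_Suc_iff)
    also have "\<dots> \<longleftrightarrow> summable (\<lambda>n. real n powr (- 1 - \<nu> * \<alpha>))"
      by (rule summable_iff_of_bigtheta[OF seq[OF st] f0]) simp
    also have "\<dots> \<longleftrightarrow> summable (\<lambda>n. real (Suc n) powr (- 1 - \<nu> * \<alpha>))"
      by (rule summable_Suc_iff[symmetric])
    finally show ?thesis using powr_summable by simp
  qed
  show ?thesis
    unfolding ex
  proof (intro conjI allI impI)
    fix k t and \<alpha> :: real
    assume st: "stokes_sequence P Q g k (r k) (\<delta> k) t"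
    show "(\<lambda>n. cmod (residue_coeff P g (t n)) / cmod (t n) powr (1 + \<alpha>))
        \<in> \<Theta>(\<lambda>n. real n powr (- 1 - \<nu> * \<alpha>))"
      using seq[OF st] unfolding f_def .
    show "summable (\<lambda>n. cmod (residue_coeff P g (t (Suc n))) / cmod (t (Suc n)) powr (1 + \<alpha>))
        \<longleftrightarrow> 0 < \<alpha>"
      using sum_t[OF st] unfolding f_def .
  next
    fix \<alpha> :: real
    assume "\<exists>k. stokes_index P Q g k (r k) (\<delta> k)"
    then have "K \<noteq> {}" by (simp add: K_def)
    from union[OF this]
    show "(\<lambda>z. cmod (residue_coeff P g z) / cmod z powr (1 + \<alpha>)) summable_on
        (\<Union>k\<in>{k. stokes_index P Q g k (r k) (\<delta> k)}. sector_zeros P Q g k (r k) (\<delta> k))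
        \<longleftrightarrow> 0 < \<alpha>"
      unfolding f_def Z_def K_def .
  qed
qed

end
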